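(* For every integer $k\ge 2$ there exists a constant $C(k)\in\mathbb{R}_+$ such that $$\lim_{\varepsilon\to 0_+}\frac{f^*_\infty(\varepsilon)}{\varepsilon^k}=C(k),$$ where $f^*_\infty(\varepsilon)=f^*_\infty(\underline{\lambda}(\varepsilon))$ with $\underline{\lambda}(\varepsilon)=\left(\frac{1+\varepsilon}{k-1},\dots,\frac{1+\varepsilon}{k-1}\right)\in\mathbb{R}_+^k$. In particular, $C(2)=4$, $C(3)=32$, and $C(4)=624$.
   Context: Notation: $\mathbb{R}_+=(0,\infty)$, $[k]=\{1,\dots,k\}$. ECBP trees. For $\underline{\lambda}=(\lambda_1,\dots,\lambda_k)\in\mathbb{R}_+^k$, $G_\infty=G_\infty(r)\sim\mathcal{G}_\infty(\underline{\lambda})$ denotes the random (possibly infinite) edge-colored tree with root $r$ generated recursively: given the tree up to generation $d$, each vertex $v$ in generation $d$ has $X_{v,i}\sim\mathrm{POI}(\lambda_i)$ children joined to it by an edge of color $i$ ($i\in[k]$), all these variables being conditionally independent. Write $v\stackrel{G_\infty^{\setminus i}}{\longleftrightarrow}w$ if the path between $v$ and $w$ contains no edge of color $i$, and $v\stackrel{G_\infty^{\setminus i}}{\longleftrightarrow}\infty$ if there is an infinite path starting at $v$ without edges of color $i$ all of whose vertices are descendants of $v$. The root $r$ and $v$ are $i$-avoiding friends if either $r\stackrel{G_\infty^{\setminus i}}{\longleftrightarrow}v$, or both $r\stackrel{G_\infty^{\setminus i}}{\longleftrightarrow}\infty$ and $v\stackrel{G_\infty^{\setminus i}}{\longleftrightarrow}\infty$.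 They are friends if they are $i$-avoiding friends for all $i\in[k]$. $\widetilde{\mathcal{C}}^*(r)$ is the set of friends of $r$ (it contains $r$), and $f^*_\infty(\underline{\lambda})=\mathbb{P}(|\widetilde{\mathcal{C}}^*(r)|=\infty)$. *)

theory Defs
  imports "HOL-Probability.Probability" "HOL-Library.Sublist"
begin

(* Ulam-Harris encoding: a vertex is the list of steps leading to it from the root [], and
   step (i, j) goes to the j-th child (counting from 0) joined by an edge of color i. *)
type_synonym vertex = "(nat \<times> nat) list"

(* The argument X gives the offspring numbers: X (v, i) is the number of children of v joined
   to v by an edge of color i.  Colors are the elements of {1..k}. *)
inductive_set ecbp_tree :: "nat \<Rightarrow> (vertex \<times> nat \<Rightarrow> nat) \<Rightarrow> vertex set"
  for k :: nat and X :: "vertex \<times> nat \<Rightarrow> nat" where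
  root: "[] \<in> ecbp_tree k X"
| child: "v @ [(i, j)] \<in> ecbp_tree k X"
    if "v \<in> ecbp_tree k X" and "i \<in> {1..k}" and "j < X (v, i)"

definition color_edge ::
    "nat \<Rightarrow> (vertex \<times> nat \<Rightarrow> nat) \<Rightarrow> nat \<Rightarrow> vertex \<Rightarrow> vertex \<Rightarrow> bool" where
  "color_edge k X i v w \<longleftrightarrow> v \<in> ecbp_tree k X \<and> w \<in> ecbp_tree k X \<and>
     (\<exists>j. w = v @ [(i, j)] \<or> v = w @ [(i, j)])"

definition edge_avoiding ::
    "nat \<Rightarrow> (vertex \<times> nat \<Rightarrow> nat) \<Rightarrow> nat \<Rightarrow> vertex \<Rightarrow> vertex \<Rightarrow> bool" where
  "edge_avoiding k X i v w \<longleftrightarrow> (\<exists>c\<in>{1..k} - {i}. color_edge k X c v w)"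

(* A path has no repeated vertices; in a tree there is exactly one path between v and w. *)
definition conn_avoiding ::
    "nat \<Rightarrow> (vertex \<times> nat \<Rightarrow> nat) \<Rightarrow> nat \<Rightarrow> vertex \<Rightarrow> vertex \<Rightarrow> bool" where
  "conn_avoiding k X i v w \<longleftrightarrow>
     (\<exists>p. p \<noteq> [] \<and> hd p = v \<and> last p = w \<and> set p \<subseteq> ecbp_tree k X \<and>
          distinct p \<and> successively (edge_avoiding k X i) p)"

(* The descendants of v are the vertices that have v as a prefix; v itself is included. *)
definition conn_infinity_avoiding ::
    "nat \<Rightarrow> (vertex \<times> nat \<Rightarrow> nat) \<Rightarrow> nat \<Rightarrow> vertex \<Rightarrow> bool" where
  "conn_infinity_avoiding k X i v \<longleftrightarrow>
     (\<exists>p :: nat \<Rightarrow> vertex. p 0 = v \<and> inj p \<and>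
          (\<forall>n. edge_avoiding k X i (p n) (p (Suc n)) \<and> prefix v (p n)))"

definition avoiding_friends ::
    "nat \<Rightarrow> (vertex \<times> nat \<Rightarrow> nat) \<Rightarrow> nat \<Rightarrow> vertex \<Rightarrow> bool" where
  "avoiding_friends k X i v \<longleftrightarrow> conn_avoiding k X i [] v \<or>
     (conn_infinity_avoiding k X i [] \<and> conn_infinity_avoiding k X i v)"

definition friends_of_root :: "nat \<Rightarrow> (vertex \<times> nat \<Rightarrow> nat) \<Rightarrow> vertex set" where
  "friends_of_root k X = {v \<in> ecbp_tree k X. \<forall>i\<in>{1..k}. avoiding_friends k X i v}"

(* The law of the tree: independent Poisson offspring numbers, one for every potential vertex
   and every color.  Those attached to lists outside the tree are never looked at. *)
definition offspring_measure :: "nat \<Rightarrow> (nat \<Rightarrow> real) \<Rightarrow> (vertex \<times> nat \<Rightarrow> nat) measure" where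
  "offspring_measure k rate =
     PiM (UNIV \<times> {1..k}) (\<lambda>(v, i). measure_pmf (poisson_pmf (rate i)))"

definition f_star_inf :: "nat \<Rightarrow> (nat \<Rightarrow> real) \<Rightarrow> real" where
  "f_star_inf k rate = measure (offspring_measure k rate)
     {X \<in> space (offspring_measure k rate). infinite (friends_of_root k X)}"

definition near_critical_rate :: "nat \<Rightarrow> real \<Rightarrow> nat \<Rightarrow> real" where
  "near_critical_rate k \<epsilon> = (\<lambda>i. (1 + \<epsilon>) / (real k - 1))"

end

theory Submission
  imports Defs
begin

text \<open>
  Only the colors that let the root escape matter. Call color i escaping at a vertex v if v has an
  infinite line of descent without color i. If some color does not escape at the root, all friends
  lie in one finite cluster. If all colors escape, every vertex v at which all colors escape
  is a friend, and almost surely there are infinitely many such v: the two events "no such v from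
  depth n on" and "no vertex at depth n" follow the same recursion, and the strict convexity of
  the Poisson generating function makes their probabilities merge
  (prob_all_escape_barren). So the quantity in question is the probability that all k colors
  escape at the root (f_star_inf_eq_prob_all_escape).

  Let q t be the probability that none of t given colors escapes. A color escapes at the root if it
  escapes at a child reached by an edge of another color, and the branches at the children are
  independent copies of the tree (prob_all_children), so
  q t = exp (\<lambda> (t q (t - 1) + (k - t) q t - k)). By inclusion-exclusion the probability that s given
  colors escape is the s-th difference p s = \<Sum>j\<le>s. (-1) ^ j (s choose j) q j (prob_escape_trapped).

  It remains to see that p s \<sim> c s \<cdot> \<epsilon> ^ s. Differences diagonalize the exponent: its j-th
  difference is \<lambda> (k - j) p j (nabla_index_weight). Sequences whose j-th differences are of order
  \<epsilon> ^ j behave like smooth functions of \<epsilon> t, and their leading coefficients multiply and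
  exponentiate as derivatives do (has_jet_mult, has_jet_exp). Comparing coefficients of order s in
  q = exp (log q) expresses p s by a sum over partitions of the s colors into blocks; every block B
  contributes (k - |B|) / (k - 1) \<cdot> c |B|. The partition with one block contains p s itself, but with
  a weight tending to (k - s) / (k - 1), which is less than 1 for s \<ge> 2, so the equation determines
  c s (nabla_asymptotics). The recursion starts with c 1 = 2, the survival asymptotics of a
  branching process of mean 1 + \<epsilon>. All terms are nonnegative, whence c k > 0, and evaluating the recursion
  gives the values for k = 2, 3, 4.
\<close>

section \<open>The tree seen from a vertex\<close>

definition subtree :: "vertex \<Rightarrow> (vertex \<times> nat \<Rightarrow> nat) \<Rightarrow> (vertex \<times> nat \<Rightarrow> nat)" where
  "subtree u X = (\<lambda>(v, i). X (u @ v, i))"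

lemma subtree_apply [simp]: "subtree u X (v, i) = X (u @ v, i)"
  by (simp add: subtree_def)

lemma subtree_Nil [simp]: "subtree [] X = X"
  by (simp add: subtree_def)

lemma subtree_subtree [simp]: "subtree v (subtree u X) = subtree (u @ v) X"
  by (auto simp: subtree_def)

lemma snoc_in_tree_iff:
  "v @ [(i, j)] \<in> ecbp_tree k X \<longleftrightarrow> v \<in> ecbp_tree k X \<and> i \<in> {1..k} \<and> j < X (v, i)"
  by (auto intro: ecbp_tree.child elim: ecbp_tree.cases)

lemma append_in_tree_iff:
  "u @ v \<in> ecbp_tree k X \<longleftrightarrow> u \<in> ecbp_tree k X \<and> v \<in> ecbp_tree k (subtree u X)"
proof (induction v rule: rev_induct)
  case Nil
  then show ?case by (simp add: ecbp_tree.root)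
next
  case (snoc s v)
  obtain i j where "s = (i, j)" by (cases s)
  with snoc show ?case
    using snoc_in_tree_iff[of "u @ v" i j k X] snoc_in_tree_iff[of v i j k "subtree u X"] by auto
qed

text \<open>The tree is generated by appending steps at the end of a vertex, but every recursion below
  conditions on the first step: a branch at the root is again such a tree.\<close>
lemma Cons_in_tree_iff:
  "(i, j) # v \<in> ecbp_tree k X \<longleftrightarrow>
     i \<in> {1..k} \<and> j < X ([], i) \<and> v \<in> ecbp_tree k (subtree [(i, j)] X)"
  using append_in_tree_iff[of "[(i, j)]" v k X] snoc_in_tree_iff[of "[]" i j k X]
  by (simp add: ecbp_tree.root)

section \<open>Escaping to infinity without a color\<close>

text \<open>The finite-depth version of escaping to infinity. Working with depths matters: the
  probabilities of infinite events only satisfy a fixed point equation, which also has the trivial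
  solution that nothing ever escapes, whereas the iteration over the depth starts from a known
  value and selects the right solution.\<close>
primrec reach :: "nat \<Rightarrow> nat \<Rightarrow> nat \<Rightarrow> (vertex \<times> nat \<Rightarrow> nat) \<Rightarrow> bool" where
  "reach k i 0 X \<longleftrightarrow> True"
| "reach k i (Suc n) X \<longleftrightarrow> (\<exists>c\<in>{1..k} - {i}. \<exists>j<X ([], c). reach k i n (subtree [(c, j)] X))"

definition escapes :: "nat \<Rightarrow> nat \<Rightarrow> (vertex \<times> nat \<Rightarrow> nat) \<Rightarrow> bool" where
  "escapes k i X \<longleftrightarrow> (\<forall>n. reach k i n X)"

lemma reach_mono: "reach k i (Suc n) X \<Longrightarrow> reach k i n X"
proof (induction n arbitrary: X)
  case (Suc n)
  then show ?case by (metis reach.simps(2))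
qed simp

lemma reach_antimono: "m \<le> n \<Longrightarrow> reach k i n X \<Longrightarrow> reach k i m X"
  by (induction n rule: dec_induct) (auto dest: reach_mono simp del: reach.simps)

text \<open>Koenig's lemma: the root has finitely many children, so if none of them escapes, the maximum
  of their depth bounds is a depth bound for the root.\<close>
lemma escapes_step:
  "escapes k i X \<longleftrightarrow> (\<exists>c\<in>{1..k} - {i}. \<exists>j<X ([], c). escapes k i (subtree [(c, j)] X))"
proof
  assume esc: "escapes k i X"
  define I where "I = (SIGMA c:{1..k} - {i}. {..<X ([], c)})"
  have fin: "finite I" by (simp add: I_def)
  show "\<exists>c\<in>{1..k} - {i}. \<exists>j<X ([], c). escapes k i (subtree [(c, j)] X)"
  proof (rule ccontr)
    assume "\<not> ?thesis"
    then have "\<forall>s\<in>I. \<exists>n. \<not> reach k i n (subtree [s] X)"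
      unfolding I_def escapes_def by blast
    then obtain N where N: "\<And>s. s \<in> I \<Longrightarrow> \<not> reach k i (N s) (subtree [s] X)" by metis
    define M where "M = Max (insert 0 (N ` I))"
    have "reach k i (Suc M) X" using esc by (simp add: escapes_def del: reach.simps)
    then obtain c j where "(c, j) \<in> I" "reach k i M (subtree [(c, j)] X)"
      using reach.simps(2)[of k i M X] unfolding I_def by blast
    moreover have "N (c, j) \<le> M" using fin \<open>(c, j) \<in> I\<close> by (auto simp: M_def)
    ultimately show False using N reach_antimono by blast
  qed
next
  assume "\<exists>c\<in>{1..k} - {i}. \<exists>j<X ([], c). escapes k i (subtree [(c, j)] X)"
  then obtain c j where *: "c \<in> {1..k} - {i}" "j < X ([], c)" "escapes k i (subtree [(c, j)] X)"
    by blast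
  have "reach k i n X" for n
  proof (cases n)
    case (Suc m)
    then show ?thesis using * unfolding escapes_def Suc reach.simps by blast
  qed simp
  then show "escapes k i X" by (simp add: escapes_def)
qed

lemma escapes_subtree_step:
  assumes "v \<in> ecbp_tree k X" "escapes k i (subtree v X)"
  shows "\<exists>c\<in>{1..k} - {i}. \<exists>j. v @ [(c, j)] \<in> ecbp_tree k X \<and> escapes k i (subtree (v @ [(c, j)]) X)"
  using assms escapes_step[of k i "subtree v X"] by (auto simp: snoc_in_tree_iff)

lemma edge_avoiding_snoc:
  assumes "v @ [(c, j)] \<in> ecbp_tree k X" "c \<noteq> i"
  shows "edge_avoiding k X i v (v @ [(c, j)])"
  using assms unfolding edge_avoiding_def color_edge_def
  by (intro bexI[of _ c]) (auto simp: snoc_in_tree_iff)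

lemma edge_avoiding_cases:
  assumes "edge_avoiding k X i v w"
  obtains c j where "c \<in> {1..k} - {i}" "w = v @ [(c, j)]" "w \<in> ecbp_tree k X"
        | c j where "c \<in> {1..k} - {i}" "v = w @ [(c, j)]" "v \<in> ecbp_tree k X"
  using assms unfolding edge_avoiding_def color_edge_def by blast

lemma reach_if_long_descent:
  assumes "\<And>m. m < n \<Longrightarrow> \<exists>c\<in>{1..k} - {i}. \<exists>j. p (Suc m) = p m @ [(c, j)] \<and> p (Suc m) \<in> ecbp_tree k X"
  shows "reach k i n (subtree (p 0) X)"
  using assms
proof (induction n arbitrary: p)
  case (Suc n)
  obtain c j where c: "c \<in> {1..k} - {i}" "p 1 = p 0 @ [(c, j)]" "p 1 \<in> ecbp_tree k X"
    using Suc.prems[of 0] by (metis One_nat_def zero_less_Suc)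
  have "reach k i n (subtree (p 1) X)"
    using Suc.IH[of "\<lambda>m. p (Suc m)"] Suc.prems by simp
  then have "reach k i n (subtree [(c, j)] (subtree (p 0) X))" using c(2) by simp
  then show ?case using c unfolding reach.simps(2) by (metis snoc_in_tree_iff subtree_apply append_Nil2)
qed simp

text \<open>A path that never repeats a vertex and stays among the descendants of v can only go down:
  its first step cannot leave v upwards, and after a step down the only step up would return to
  the vertex just left.\<close>
lemma conn_infinity_avoiding_iff_escapes:
  assumes "v \<in> ecbp_tree k X"
  shows "conn_infinity_avoiding k X i v \<longleftrightarrow> escapes k i (subtree v X)"
proof
  assume "conn_infinity_avoiding k X i v"
  then obtain p where p: "p 0 = v" "inj p" "\<And>n. edge_avoiding k X i (p n) (p (Suc n))"
    "\<And>n. prefix v (p n)"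
    unfolding conn_infinity_avoiding_def by auto
  \<comment> \<open>A step up would either leave the descendants of v or repeat the vertex before.\<close>
  have down: "\<exists>c\<in>{1..k} - {i}. \<exists>j. p (Suc n) = p n @ [(c, j)] \<and> p (Suc n) \<in> ecbp_tree k X" for n
  proof (induction n)
    case 0
    from p(3)[of 0] show ?case
    proof (cases rule: edge_avoiding_cases)
      case (2 c j)
      then show ?thesis using p(4)[of 1] p(1) by (auto dest: prefix_length_le)
    qed (use p in auto)
  next
    case (Suc n)
    from p(3)[of "Suc n"] show ?case
    proof (cases rule: edge_avoiding_cases)
      case (2 c j)
      then have "p (Suc (Suc n)) = p n" using Suc by auto
      with p(2) have "Suc (Suc n) = n" by (simp add: inj_eq)
      then show ?thesis by simp
    qed auto
  qed
  show "escapes k i (subtree v X)"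
    unfolding escapes_def using reach_if_long_descent[of _ k i p X] down p(1) by auto
next
  assume esc: "escapes k i (subtree v X)"
  define Q where "Q w \<longleftrightarrow> w \<in> ecbp_tree k X \<and> escapes k i (subtree w X) \<and> prefix v w" for w
  have "\<exists>w'. Q w' \<and> (\<exists>c\<in>{1..k} - {i}. \<exists>j. w' = w @ [(c, j)])" if "Q w" for w
    using escapes_subtree_step[of w k X i] that unfolding Q_def by fastforce
  moreover have "Q v" using assms esc by (simp add: Q_def)
  ultimately obtain h where h: "\<And>w. Q w \<Longrightarrow> Q (h w) \<and> (\<exists>c\<in>{1..k} - {i}. \<exists>j. h w = w @ [(c, j)])"
    by metis
  define p where "p n = (h ^^ n) v" for n
  have p0: "p 0 = v" by (simp add: p_def)
  have pQ: "Q (p n)" for n by (induction n) (use h \<open>Q v\<close> in \<open>auto simp: p_def\<close>)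
  have pS: "\<exists>c\<in>{1..k} - {i}. \<exists>j. p (Suc n) = p n @ [(c, j)]" for n
    using h[OF pQ[of n]] by (simp add: p_def)
  have len: "length (p n) = length v + n" for n
  proof (induction n)
    case (Suc n)
    then show ?case using pS[of n] by auto
  qed (simp add: p0)
  have "inj p"
  proof (rule injI)
    fix m n assume "p m = p n"
    then have "length (p m) = length (p n)" by (rule arg_cong)
    then show "m = n" unfolding len by (rule add_left_imp_eq)
  qed
  moreover have "edge_avoiding k X i (p n) (p (Suc n))" for n
  proof -
    obtain c j where c: "c \<in> {1..k} - {i}" "p (Suc n) = p n @ [(c, j)]" using pS by blast
    with pQ[of "Suc n"] show ?thesis using edge_avoiding_snoc[of "p n" c j k X i] by (auto simp: Q_def)
  qed
  ultimately show "conn_infinity_avoiding k X i v"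
    unfolding conn_infinity_avoiding_def using p0 pQ by (auto simp: Q_def)
qed

section \<open>Friends of the root\<close>

text \<open>In Ulam-Harris notation a vertex records the colors of all edges between it and the root,
  and a walk that uses no edge of color i never creates or crosses such an entry.\<close>
lemma conn_avoiding_root_colors:
  assumes "conn_avoiding k X i [] v"
  shows "v \<in> ecbp_tree k X \<and> i \<notin> fst ` set v"
proof -
  obtain p where p: "p \<noteq> []" "hd p = []" "last p = v" "set p \<subseteq> ecbp_tree k X"
    "successively (edge_avoiding k X i) p"
    using assms by (auto simp: conn_avoiding_def)
  have "i \<notin> fst ` set (last p)" using p(1,5) \<open>hd p = []\<close>
  proof (induction p rule: rev_nonempty_induct)
    case (snoc x xs)
    have "edge_avoiding k X i (last xs) x" "successively (edge_avoiding k X i) xs"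
      using snoc by (auto simp: successively_append_iff)
    with snoc have "i \<notin> fst ` set (last xs)" by simp
    with \<open>edge_avoiding k X i (last xs) x\<close> show ?case
      by (auto elim!: edge_avoiding_cases)
  qed simp
  then show ?thesis using p by auto
qed

text \<open>Bounded depth and finitely many children at every vertex.\<close>
lemma finite_avoiding_cluster:
  assumes "\<not> reach k i n X"
  shows "finite {v \<in> ecbp_tree k X. i \<notin> fst ` set v}"
  using assms
proof (induction n arbitrary: X)
  case (Suc n)
  have "finite {v \<in> ecbp_tree k (subtree [s] X). i \<notin> fst ` set v}"
    if "s \<in> (SIGMA c:{1..k} - {i}. {..<X ([], c)})" for s
    using Suc that by auto
  then have "finite (insert [] (\<Union>s\<in>(SIGMA c:{1..k} - {i}. {..<X ([], c)}).
      (#) s ` {v \<in> ecbp_tree k (subtree [s] X). i \<notin> fst ` set v}))"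
    by (intro finite.insertI finite_UN_I finite_imageI) auto
  moreover have "{v \<in> ecbp_tree k X. i \<notin> fst ` set v} \<subseteq> \<dots>"
  proof safe
    fix v assume v: "v \<in> ecbp_tree k X" "i \<notin> fst ` set v" "v \<notin> (\<Union>s\<in>(SIGMA c:{1..k} - {i}. {..<X ([], c)}).
      (#) s ` {v \<in> ecbp_tree k (subtree [s] X). i \<notin> fst ` set v})"
    show "v = []"
    proof (cases "v = []")
      case False
      then obtain c j w where w: "v = (c, j) # w" by (cases v) auto
      with v(1,2) have "(c, j) \<in> (SIGMA c:{1..k} - {i}. {..<X ([], c)})"
        "w \<in> ecbp_tree k (subtree [(c, j)] X)" "i \<notin> fst ` set w"
        by (auto simp: Cons_in_tree_iff)
      with v(3) w show ?thesis by blast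
    qed
  qed
  ultimately show ?case by (rule finite_subset[rotated])
qed simp

definition all_escape :: "nat \<Rightarrow> (vertex \<times> nat \<Rightarrow> nat) \<Rightarrow> bool" where
  "all_escape k X \<longleftrightarrow> (\<forall>i\<in>{1..k}. escapes k i X)"

text \<open>If color i does not let the root escape, every friend has to be connected to the root
  without color i, and that cluster is finite.\<close>
lemma all_escape_if_infinitely_many_friends:
  assumes "infinite (friends_of_root k X)"
  shows "all_escape k X"
  unfolding all_escape_def
proof (rule ballI, rule ccontr)
  fix i assume i: "i \<in> {1..k}" "\<not> escapes k i X"
  then have "\<not> conn_infinity_avoiding k X i []"
    using conn_infinity_avoiding_iff_escapes[of "[]" k X i] by (simp add: ecbp_tree.root)
  then have "friends_of_root k X \<subseteq> {v \<in> ecbp_tree k X. i \<notin> fst ` set v}"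
    using i(1) conn_avoiding_root_colors unfolding friends_of_root_def avoiding_friends_def by blast
  moreover obtain n where "\<not> reach k i n X" using i(2) by (auto simp: escapes_def)
  ultimately show False using assms finite_subset[OF _ finite_avoiding_cluster] by blast
qed

text \<open>Two vertices that both escape for every color are friends, whatever the path between them.\<close>
lemma infinitely_many_friends_if:
  assumes "all_escape k X" "infinite {v \<in> ecbp_tree k X. all_escape k (subtree v X)}"
  shows "infinite (friends_of_root k X)"
proof -
  have "{v \<in> ecbp_tree k X. all_escape k (subtree v X)} \<subseteq> friends_of_root k X"
    using assms(1) conn_infinity_avoiding_iff_escapes[of _ k X] ecbp_tree.root[of k X]
    by (auto simp: friends_of_root_def avoiding_friends_def all_escape_def)
  then show ?thesis using assms(2) finite_subset by blast
qed

section \<open>Independence of the branches\<close>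

locale ecbp =
  fixes k :: nat and rate :: "nat \<Rightarrow> real"
  assumes k_pos: "k \<ge> 1" and rate_pos: "\<And>i. rate i > 0"
begin

abbreviation (input) I :: "(vertex \<times> nat) set" where "I \<equiv> UNIV \<times> {1..k}"

abbreviation M :: "(vertex \<times> nat \<Rightarrow> nat) measure" where "M \<equiv> offspring_measure k rate"

definition offspring_law :: "vertex \<times> nat \<Rightarrow> nat measure" where
  "offspring_law s = measure_pmf (poisson_pmf (rate (snd s)))"

lemma M_eq: "M = PiM I offspring_law"
  unfolding offspring_measure_def offspring_law_def by (intro PiM_cong) auto

lemma prob_space_offspring_law: "prob_space (offspring_law s)"
  by (simp add: offspring_law_def measure_pmf.prob_space_axioms)

lemma space_offspring_law [simp]: "space (offspring_law s) = UNIV"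
  and sets_offspring_law [simp]: "sets (offspring_law s) = UNIV"
  by (simp_all add: offspring_law_def)

sublocale prob_space M
  unfolding M_eq by (intro prob_space_PiM prob_space_offspring_law)

lemma in_space_iff: "X \<in> space M \<longleftrightarrow> X \<in> extensional I"
  by (auto simp: M_eq space_PiM PiE_def)

lemma measurable_offspring: "(\<lambda>X. X s) \<in> M \<rightarrow>\<^sub>M count_space UNIV"
proof (cases "s \<in> I")
  case True
  then have "(\<lambda>X. X s) \<in> M \<rightarrow>\<^sub>M offspring_law s"
    unfolding M_eq by (rule measurable_component_singleton)
  then show ?thesis by (simp add: offspring_law_def)
next
  case False
  have "(\<lambda>X. X s) \<in> M \<rightarrow>\<^sub>M count_space UNIV \<longleftrightarrow> (\<lambda>X. undefined :: nat) \<in> M \<rightarrow>\<^sub>M count_space UNIV"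
    using False by (intro measurable_cong) (auto simp: in_space_iff intro: extensional_arb)
  then show ?thesis by simp
qed

text \<open>The branch above u only looks at coordinates whose vertex extends u. This is stated for a set
  B of coordinates so that the independence of disjoint sets of coordinates applies to branches.\<close>
lemma measurable_subtree_block:
  assumes "\<And>v i. i \<in> {1..k} \<Longrightarrow> (u @ v, i) \<in> B" "B \<subseteq> I"
  shows "subtree u \<in> PiM B offspring_law \<rightarrow>\<^sub>M M"
  unfolding M_eq
proof (rule measurable_PiM_single')
  fix s assume s: "s \<in> I"
  obtain v i where "s = (v, i)" by (cases s)
  then show "(\<lambda>X. subtree u X s) \<in> PiM B offspring_law \<rightarrow>\<^sub>M offspring_law s"
    using measurable_component_singleton[of "(u @ v, i)" B offspring_law] assms(1) s
    by (simp add: offspring_law_def)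
next
  have "\<And>v i. i \<notin> {1..k} \<Longrightarrow> (v, i) \<notin> B" using assms(2) by auto
  then show "subtree u \<in> space (PiM B offspring_law) \<rightarrow> (\<Pi>\<^sub>E s\<in>I. space (offspring_law s))"
    by (auto simp: space_PiM PiE_def extensional_def)
qed

lemma measurable_subtree: "subtree u \<in> M \<rightarrow>\<^sub>M M"
  using measurable_subtree_block[of u I] by (simp add: M_eq)

text \<open>The branch at a fixed vertex has the law of the whole tree, because the offspring law
  depends on the color but not on the vertex.\<close>
lemma distr_subtree: "distr M M (subtree u) = M"
proof -
  define f where "f s = (u @ fst s, snd s)" for s :: "vertex \<times> nat"
  have "distr M (PiM I (\<lambda>s. offspring_law (f s))) (\<lambda>\<omega>. \<lambda>n\<in>I. \<omega> (f n)) = PiM I (\<lambda>s. offspring_law (f s))"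
    unfolding M_eq
    by (rule distr_PiM_reindex) (auto simp: f_def inj_on_def prob_space_offspring_law)
  moreover have "PiM I (\<lambda>s. offspring_law (f s)) = M"
    unfolding M_eq by (intro PiM_cong) (auto simp: f_def offspring_law_def)
  ultimately have "distr M M (\<lambda>\<omega>. \<lambda>n\<in>I. \<omega> (f n)) = M" by (simp only:)
  moreover have "distr M M (\<lambda>\<omega>. \<lambda>n\<in>I. \<omega> (f n)) = distr M M (subtree u)"
    by (intro distr_cong) (auto simp: in_space_iff extensional_def fun_eq_iff f_def)
  ultimately show ?thesis by simp
qed

lemma prob_subtree:
  assumes "Measurable.pred M Q"
  shows "prob {X \<in> space M. Q (subtree u X)} = prob {X \<in> space M. Q X}"
proof -
  have "prob {X \<in> space M. Q X} = measure (distr M M (subtree u)) {X \<in> space M. Q X}"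
    by (simp add: distr_subtree)
  also have "\<dots> = prob (subtree u -` {X \<in> space M. Q X} \<inter> space M)"
    using assms by (intro measure_distr measurable_subtree) simp
  also have "subtree u -` {X \<in> space M. Q X} \<inter> space M = {X \<in> space M. Q (subtree u X)}"
    using measurable_space[OF measurable_subtree] by auto
  finally show ?thesis by simp
qed

lemma indep_offspring: "indep_vars offspring_law (\<lambda>s X. X s) I"
proof -
  have rv: "(\<lambda>X. X s) \<in> M \<rightarrow>\<^sub>M offspring_law s" if "s \<in> I" for s
    using that unfolding M_eq by (rule measurable_component_singleton)
  have "distr M (PiM I offspring_law) (\<lambda>X. \<lambda>s\<in>I. X s) = distr M M (\<lambda>X. X)"
    by (intro distr_cong) (simp_all only: M_eq[symmetric] in_space_iff extensional_restrict)
  also have "\<dots> = PiM I (\<lambda>s. distr M (offspring_law s) (\<lambda>X. X s))"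
    unfolding distr_id[unfolded id_def] unfolding M_eq
    by (intro PiM_cong refl sym[OF distr_PiM_component]) (auto simp: prob_space_offspring_law)
  finally show ?thesis
    using indep_vars_iff_distr_eq_PiM'[of I "\<lambda>s X. X s" offspring_law] rv k_pos by auto
qed

lemma prob_blocks:
  assumes "finite J" "J \<noteq> {}" "disjoint_family_on B J" "\<And>j. j \<in> J \<Longrightarrow> B j \<subseteq> I"
    and meas: "\<And>j. j \<in> J \<Longrightarrow> Measurable.pred (PiM (B j) offspring_law) (Q j)"
    and local: "\<And>j X. j \<in> J \<Longrightarrow> X \<in> space M \<Longrightarrow> Q j (restrict X (B j)) \<longleftrightarrow> R j X"
  shows "prob {X \<in> space M. \<forall>j\<in>J. R j X} = (\<Prod>j\<in>J. prob {X \<in> space M. R j X})"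
proof -
  have ind: "indep_vars (\<lambda>j. PiM (B j) offspring_law) (\<lambda>j X. restrict (\<lambda>s. X s) (B j)) J"
    by (rule indep_vars_restrict[OF indep_offspring]) (use assms in auto)
  have eq: "(\<lambda>X. restrict (\<lambda>s. X s) (B j)) -` {Y \<in> space (PiM (B j) offspring_law). Q j Y} \<inter> space M
      = {X \<in> space M. R j X}" if "j \<in> J" for j
    using local[OF that] by (auto simp: space_PiM)
  have "prob (\<Inter>j\<in>J. (\<lambda>X. restrict (\<lambda>s. X s) (B j)) -` {Y \<in> space (PiM (B j) offspring_law). Q j Y} \<inter> space M)
     = (\<Prod>j\<in>J. prob ((\<lambda>X. restrict (\<lambda>s. X s) (B j)) -` {Y \<in> space (PiM (B j) offspring_law). Q j Y} \<inter> space M))"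
    by (rule indep_varsD[OF ind]) (use assms in auto)
  also have "(\<Inter>j\<in>J. (\<lambda>X. restrict (\<lambda>s. X s) (B j)) -` {Y \<in> space (PiM (B j) offspring_law). Q j Y} \<inter> space M)
      = {X \<in> space M. \<forall>j\<in>J. R j X}"
    using eq \<open>J \<noteq> {}\<close> by auto
  also have "(\<Prod>j\<in>J. prob ((\<lambda>X. restrict (\<lambda>s. X s) (B j)) -` {Y \<in> space (PiM (B j) offspring_law). Q j Y} \<inter> space M))
      = (\<Prod>j\<in>J. prob {X \<in> space M. R j X})"
    by (intro prod.cong refl arg_cong[of _ _ prob] eq)
  finally show ?thesis .
qed

lemma prob_offspring_eq:
  assumes "c \<in> {1..k}"
  shows "prob {X \<in> space M. X (v, c) = n} = rate c ^ n / fact n * exp (- rate c)"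
proof -
  have "prob {X \<in> space M. X (v, c) = n} = measure (distr M (offspring_law (v, c)) (\<lambda>X. X (v, c))) {n}"
    using assms
    by (subst measure_distr) (auto simp: M_eq vimage_def Int_def conj_commute intro!: measurable_component_singleton)
  also have "distr M (offspring_law (v, c)) (\<lambda>X. X (v, c)) = offspring_law (v, c)"
    unfolding M_eq using assms by (intro distr_PiM_component prob_space_offspring_law) auto
  also have "measure (offspring_law (v, c)) {n} = pmf (poisson_pmf (rate c)) n"
    by (simp add: offspring_law_def measure_pmf_single)
  finally show ?thesis using rate_pos by simp
qed

text \<open>The number of children is Poisson and their branches are independent of it and of each other.
  Summing over the number of children gives the Poisson generating function at the probability
  that a single branch is good.\<close>
lemma prob_children_of_color:
  assumes c: "c \<in> {1..k}" and Q: "Measurable.pred M Q"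
  shows "prob {X \<in> space M. \<forall>j<X ([], c). Q (subtree [(c, j)] X)}
    = exp (- (rate c * (1 - prob {X \<in> space M. Q X})))" (is "_ = exp (- (_ * (1 - ?p)))")
proof -
  note [measurable] = Q measurable_subtree measurable_offspring
  define E where "E n = {X \<in> space M. X ([], c) = n \<and> (\<forall>j<n. Q (subtree [(c, j)] X))}" for n
  have E: "E n \<in> events" for n unfolding E_def by measurable
  have probE: "prob (E n) = rate c ^ n / fact n * exp (- rate c) * ?p ^ n" for n
  proof -
    define B where "B s = (case s of None \<Rightarrow> {([], c)} | Some j \<Rightarrow> range (\<lambda>v. (c, j) # v) \<times> {1..k})"
      for s :: "nat option"
    define R where "R s X = (case s of None \<Rightarrow> X ([], c) = n | Some j \<Rightarrow> Q (subtree [(c, j)] X))"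
      for s :: "nat option" and X
    have "prob {X \<in> space M. \<forall>s\<in>insert None (Some ` {..<n}). R s X}
        = (\<Prod>s\<in>insert None (Some ` {..<n}). prob {X \<in> space M. R s X})"
    proof (rule prob_blocks[where B = B and Q = R])
      show "disjoint_family_on B (insert None (Some ` {..<n}))"
        by (auto simp: disjoint_family_on_def B_def split: option.splits)
      show "B s \<subseteq> I" for s using c by (auto simp: B_def split: option.splits)
      show "Measurable.pred (PiM (B s) offspring_law) (R s)" for s
      proof (cases s)
        case None
        have "(\<lambda>X. X ([], c)) \<in> PiM (B s) offspring_law \<rightarrow>\<^sub>M offspring_law ([], c)"
          by (rule measurable_component_singleton) (simp add: None B_def)
        then have "(\<lambda>X. X ([], c)) \<in> PiM (B s) offspring_law \<rightarrow>\<^sub>M count_space UNIV"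
          by (simp add: offspring_law_def)
        from measurable_compose[OF this, of "\<lambda>m. m = n" "count_space UNIV"] show ?thesis
          by (simp add: R_def[abs_def] None)
      next
        case (Some j)
        have "subtree [(c, j)] \<in> PiM (B s) offspring_law \<rightarrow>\<^sub>M M"
          by (rule measurable_subtree_block) (use c in \<open>auto simp: Some B_def\<close>)
        from measurable_compose[OF this Q] show ?thesis
          by (simp add: R_def[abs_def] Some)
      qed
      show "R s (restrict X (B s)) \<longleftrightarrow> R s X" if "X \<in> space M" for s X
      proof (cases s)
        case (Some j)
        have "subtree [(c, j)] (restrict X (B s)) = subtree [(c, j)] X"
          using that by (auto simp: Some B_def fun_eq_iff in_space_iff extensional_def)
        then show ?thesis by (simp add: R_def Some)
      qed (simp add: R_def B_def)
    qed auto
    also have "{X \<in> space M. \<forall>s\<in>insert None (Some ` {..<n}). R s X} = E n"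
      by (auto simp: E_def R_def)
    also have "(\<Prod>s\<in>insert None (Some ` {..<n}). prob {X \<in> space M. R s X})
        = prob {X \<in> space M. X ([], c) = n} * (\<Prod>j<n. prob {X \<in> space M. Q (subtree [(c, j)] X)})"
      by (subst prod.insert) (auto simp: R_def prod.reindex)
    finally show ?thesis using prob_offspring_eq[OF c] prob_subtree[OF Q] by simp
  qed
  have "(\<lambda>n. prob (E n)) sums prob (\<Union>n. E n)"
    by (rule finite_measure_UNION) (use E in \<open>auto simp: disjoint_family_on_def E_def\<close>)
  also have "(\<Union>n. E n) = {X \<in> space M. \<forall>j<X ([], c). Q (subtree [(c, j)] X)}"
    by (auto simp: E_def)
  finally have "(\<lambda>n. prob (E n)) sums prob {X \<in> space M. \<forall>j<X ([], c). Q (subtree [(c, j)] X)}" .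
  moreover have "(\<lambda>n. prob (E n)) sums (exp (- rate c) * exp (rate c * ?p))"
    using sums_mult[OF exp_converges[of "rate c * ?p"], of "exp (- rate c)"]
    by (simp add: probE power_mult_distrib divide_inverse mult_ac)
  ultimately have "prob {X \<in> space M. \<forall>j<X ([], c). Q (subtree [(c, j)] X)} = exp (- rate c) * exp (rate c * ?p)"
    by (rule sums_unique2)
  then show ?thesis by (simp add: exp_add[symmetric] algebra_simps)
qed

text \<open>The branching recursion. Children of different colors depend on disjoint sets of coordinates,
  so the generating functions of the colors multiply. All probabilities in the sequel are computed
  by iterating this identity.\<close>
theorem prob_all_children:
  assumes Q: "\<And>c. c \<in> {1..k} \<Longrightarrow> Measurable.pred M (Q c)"
  shows "prob {X \<in> space M. \<forall>c\<in>{1..k}. \<forall>j<X ([], c). Q c (subtree [(c, j)] X)}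
    = exp (- (\<Sum>c=1..k. rate c * (1 - prob {X \<in> space M. Q c X})))"
proof -
  define B where "B c = {(v :: vertex, i :: nat). i \<in> {1..k} \<and> (v = [] \<and> i = c \<or> v \<noteq> [] \<and> fst (hd v) = c)}"
    for c :: nat
  define R where "R c X \<longleftrightarrow> (\<forall>j<X ([], c). Q c (subtree [(c, j)] X))" for c X
  have "prob {X \<in> space M. \<forall>c\<in>{1..k}. R c X} = (\<Prod>c\<in>{1..k}. prob {X \<in> space M. R c X})"
  proof (rule prob_blocks[where B = B and Q = R])
    show "disjoint_family_on B {1..k}" by (auto simp: disjoint_family_on_def B_def)
    fix c assume c: "c \<in> {1..k}"
    show "B c \<subseteq> I" using c by (auto simp: B_def)
    show "R c (restrict X (B c)) \<longleftrightarrow> R c X" if "X \<in> space M" for X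
    proof -
      have "subtree [(c, j)] (restrict X (B c)) = subtree [(c, j)] X" for j
        using that by (auto simp: B_def fun_eq_iff in_space_iff extensional_def)
      moreover have "([], c) \<in> B c" using c by (simp add: B_def)
      ultimately show ?thesis by (simp add: R_def)
    qed
    have "(\<lambda>X. X ([], c)) \<in> PiM (B c) offspring_law \<rightarrow>\<^sub>M offspring_law ([], c)"
      by (rule measurable_component_singleton) (use c in \<open>simp add: B_def\<close>)
    then have [measurable]: "(\<lambda>X. X ([], c)) \<in> PiM (B c) offspring_law \<rightarrow>\<^sub>M count_space UNIV"
      by (simp add: offspring_law_def)
    have [measurable]: "subtree [(c, j)] \<in> PiM (B c) offspring_law \<rightarrow>\<^sub>M M" for j
      by (rule measurable_subtree_block) (use c in \<open>auto simp: B_def\<close>)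
    note [measurable] = Q[OF c]
    show "Measurable.pred (PiM (B c) offspring_law) (R c)"
      unfolding R_def by measurable
  qed (use k_pos in auto)
  also have "\<dots> = (\<Prod>c\<in>{1..k}. exp (- (rate c * (1 - prob {X \<in> space M. Q c X}))))"
    unfolding R_def by (intro prod.cong refl prob_children_of_color Q)
  also have "\<dots> = exp (- (\<Sum>c=1..k. rate c * (1 - prob {X \<in> space M. Q c X})))"
    by (simp add: exp_sum[symmetric] sum_negf)
  finally show ?thesis by (simp add: R_def)
qed

end

section \<open>Infinitely many friends, almost surely\<close>

lemma infinite_iff_to_nat_unbounded:
  fixes S :: "'a :: countable set"
  shows "infinite S \<longleftrightarrow> (\<forall>n. \<exists>v\<in>S. n < to_nat v)"
proof -
  have "infinite S \<longleftrightarrow> infinite (to_nat ` S)"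
    by (simp add: finite_image_iff)
  also have "\<dots> \<longleftrightarrow> (\<forall>n. \<exists>v\<in>S. n < to_nat v)"
  proof -
    have "(\<exists>m>n. m \<in> to_nat ` S) \<longleftrightarrow> (\<exists>v\<in>S. n < to_nat v)" for n by auto
    then show ?thesis unfolding infinite_nat_iff_unbounded by simp
  qed
  finally show ?thesis .
qed

text \<open>The function u \<mapsto> 1 - exp (- m u) is strictly concave and vanishes at 0, so left of its
  positive fixed point w it lies strictly above the diagonal. The proof applies the tangent
  inequality of the exponential at - m u to the two end points 0 and - m w.\<close>
lemma convexity_gap:
  fixes m u w :: real
  assumes "m > 0" "u > 0" "u < w" "w = 1 - exp (- m * w)"
  shows "u < 1 - exp (- m * u)"
proof -
  have "1 + m * u < exp (m * u)"
    using exp_lower_Taylor_quadratic[of "m * u"] mult_pos_pos[OF assms(1,2)] zero_less_power[of "m * u" 2]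
    by linarith
  then have a: "(1 + m * u) * exp (- m * u) < 1"
    by (simp add: exp_minus field_simps)
  have "1 + (m * u - m * w) \<le> exp (m * u - m * w)" by (rule exp_ge_add_one_self)
  then have "(1 + (m * u - m * w)) * exp (- m * u) \<le> exp (m * u - m * w) * exp (- m * u)"
    by (intro mult_right_mono) auto
  also have "\<dots> = exp (- m * w)" by (simp add: exp_add[symmetric])
  finally have b: "(1 + (m * u - m * w)) * exp (- m * u) \<le> 1 - w" using assms by simp
  have "(w - u) * ((1 + m * u) * exp (- m * u)) + u * ((1 + (m * u - m * w)) * exp (- m * u))
      < (w - u) * 1 + u * (1 - w)"
    using a b assms by (intro add_less_le_mono mult_strict_left_mono mult_left_mono) auto
  then have "w * exp (- m * u) < w * (1 - u)" by (simp add: algebra_simps)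
  then show ?thesis using assms by simp
qed

context ecbp
begin

lemma measurable_reach: "Measurable.pred M (reach k i n)"
proof (induction n)
  case (Suc n)
  note [measurable] = Suc measurable_offspring measurable_subtree
  show ?case unfolding reach.simps by measurable
qed (simp add: reach.simps)

lemma measurable_escapes: "Measurable.pred M (escapes k i)"
proof -
  note [measurable] = measurable_reach
  show ?thesis unfolding escapes_def by measurable
qed

lemma measurable_all_escape: "Measurable.pred M (all_escape k)"
proof -
  note [measurable] = measurable_escapes
  show ?thesis unfolding all_escape_def by measurable
qed

lemma measurable_in_tree: "Measurable.pred M (\<lambda>X. v \<in> ecbp_tree k X)"
proof (induction v rule: rev_induct)
  case Nil
  then show ?case by (simp add: ecbp_tree.root)
next
  case (snoc s v)
  obtain i j where s: "s = (i, j)" by (cases s)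
  note [measurable] = snoc measurable_offspring
  show ?case unfolding s snoc_in_tree_iff by measurable
qed

lemma measurable_edge_avoiding: "Measurable.pred M (\<lambda>X. edge_avoiding k X i v w)"
proof -
  note [measurable] = measurable_in_tree
  show ?thesis unfolding edge_avoiding_def color_edge_def by measurable
qed

text \<open>Vertices, hence finite paths, form a countable type, so the quantifier over paths is a
  countable union.\<close>
lemma measurable_conn_avoiding: "Measurable.pred M (\<lambda>X. conn_avoiding k X i v w)"
proof -
  note [measurable] = measurable_in_tree measurable_edge_avoiding
  show ?thesis unfolding conn_avoiding_def successively_conv_nth subset_iff by measurable
qed

lemma measurable_friend: "Measurable.pred M (\<lambda>X. v \<in> friends_of_root k X)"
proof -
  note [measurable] = measurable_in_tree measurable_conn_avoiding measurable_escapes measurable_subtree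
  have "v \<in> friends_of_root k X \<longleftrightarrow> v \<in> ecbp_tree k X \<and> (\<forall>i\<in>{1..k}. conn_avoiding k X i [] v \<or>
      escapes k i X \<and> escapes k i (subtree v X))" for X
    using conn_infinity_avoiding_iff_escapes[of v k X] conn_infinity_avoiding_iff_escapes[of "[]" k X]
    by (auto simp: friends_of_root_def avoiding_friends_def ecbp_tree.root)
  then show ?thesis by simp
qed

text \<open>A set that is not measurable has measure 0 by convention, so the probability of infinitely
  many friends says nothing before its measurability is known.\<close>
lemma measurable_infinite_friends: "Measurable.pred M (\<lambda>X. infinite (friends_of_root k X))"
proof -
  note [measurable] = measurable_friend
  show ?thesis unfolding infinite_iff_to_nat_unbounded Bex_def by measurable
qed

definition shorter :: "nat \<Rightarrow> (vertex \<times> nat \<Rightarrow> nat) \<Rightarrow> bool" where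
  "shorter n X \<longleftrightarrow> (\<forall>v\<in>ecbp_tree k X. length v < n)"

definition barren :: "nat \<Rightarrow> (vertex \<times> nat \<Rightarrow> nat) \<Rightarrow> bool" where
  "barren n X \<longleftrightarrow> (\<forall>v\<in>ecbp_tree k X. n \<le> length v \<longrightarrow> \<not> all_escape k (subtree v X))"

lemma ball_tree_iff:
  "(\<forall>v\<in>ecbp_tree k X. P v) \<longleftrightarrow>
     P [] \<and> (\<forall>c\<in>{1..k}. \<forall>j<X ([], c). \<forall>w\<in>ecbp_tree k (subtree [(c, j)] X). P ((c, j) # w))"
  (is "?L \<longleftrightarrow> ?R")
proof
  assume ?L
  then show ?R by (auto simp: Cons_in_tree_iff ecbp_tree.root)
next
  assume R: ?R
  show ?L
  proof
    fix v assume v: "v \<in> ecbp_tree k X"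
    show "P v"
    proof (cases "v = []")
      case False
      then obtain c j w where "v = (c, j) # w" by (cases v) auto
      with R v show ?thesis by (auto simp: Cons_in_tree_iff)
    qed (use R in simp)
  qed
qed

lemma shorter_Suc: "shorter (Suc n) X \<longleftrightarrow> (\<forall>c\<in>{1..k}. \<forall>j<X ([], c). shorter n (subtree [(c, j)] X))"
  unfolding shorter_def by (subst ball_tree_iff) simp

lemma barren_Suc: "barren (Suc n) X \<longleftrightarrow> (\<forall>c\<in>{1..k}. \<forall>j<X ([], c). barren n (subtree [(c, j)] X))"
  unfolding barren_def by (subst ball_tree_iff) simp

lemma measurable_shorter: "Measurable.pred M (shorter n)"
proof -
  note [measurable] = measurable_in_tree
  show ?thesis unfolding shorter_def Ball_def by measurable
qed

lemma measurable_barren: "Measurable.pred M (barren n)"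
proof -
  note [measurable] = measurable_in_tree measurable_subtree measurable_all_escape
  show ?thesis unfolding barren_def Ball_def by measurable
qed

lemma not_shorter_if_reach: "reach k i n X \<Longrightarrow> \<not> shorter n X"
proof (induction n arbitrary: X)
  case 0
  then show ?case by (auto simp: shorter_def intro: ecbp_tree.root)
next
  case (Suc n)
  then show ?case by (auto simp: shorter_Suc)
qed

lemma not_shorter_if_all_escape: "all_escape k X \<Longrightarrow> \<not> shorter n X"
  using not_shorter_if_reach[of 1 n X] k_pos by (auto simp: all_escape_def escapes_def)

text \<open>Being barren from depth n on and being shorter than n satisfy the same one-step recursion;
  write y n and x n for their probabilities. The x n increase to the extinction probability q, the
  smallest fixed point. If y 0 = 1, almost surely all colors escape nowhere. Otherwise y 0 \<le> y 1 says that
  1 - y 0 is a positive supersolution of the concave equation u = 1 - exp (- m u), so 1 - y 0 \<ge> 1 - q, and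
  y n \<le> q follows for all n. For n \<ge> j, a tree in the event below is barren from depth n on but not
  shorter than n, which has probability at most y n - x n \<le> q - x n, and this tends to 0.\<close>
lemma prob_all_escape_barren: "prob {X \<in> space M. all_escape k X \<and> barren j X} = 0"
proof -
  note [measurable] = measurable_shorter measurable_barren measurable_all_escape
  define m where "m = (\<Sum>c=1..k. rate c)"
  define x where "x n = prob {X \<in> space M. shorter n X}" for n
  define y where "y n = prob {X \<in> space M. barren n X}" for n
  have m: "m > 0" unfolding m_def using k_pos rate_pos by (intro sum_pos) auto
  have x_Suc: "x (Suc n) = exp (- m * (1 - x n))" for n
    unfolding x_def shorter_Suc
    using prob_all_children[of "\<lambda>_. shorter n", OF measurable_shorter] by (simp add: m_def sum_distrib_right)
  have y_Suc: "y (Suc n) = exp (- m * (1 - y n))" for n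
    unfolding y_def barren_Suc
    using prob_all_children[of "\<lambda>_. barren n", OF measurable_barren] by (simp add: m_def sum_distrib_right)
  have mono_x: "x n \<le> x (Suc n)" for n
    unfolding x_def
  proof (rule finite_measure_mono)
    show "{X \<in> space M. shorter n X} \<subseteq> {X \<in> space M. shorter (Suc n) X}" by (auto simp: shorter_def)
  qed measurable
  have mono_y: "y n \<le> y (Suc n)" for n
    unfolding y_def
  proof (rule finite_measure_mono)
    show "{X \<in> space M. barren n X} \<subseteq> {X \<in> space M. barren (Suc n) X}" by (auto simp: barren_def)
  qed measurable
  show ?thesis
  proof (cases "y 0 < 1")
    case False
    then have "y 0 = 1" using prob_le_1[of "{X \<in> space M. barren 0 X}"] by (simp add: y_def)
    moreover have "y 0 + prob {X \<in> space M. all_escape k X \<and> barren j X} \<le> 1"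
    proof -
      have "{X \<in> space M. barren 0 X} \<inter> {X \<in> space M. all_escape k X \<and> barren j X} = {}"
        unfolding barren_def using ecbp_tree.root[of k] by fastforce
      then show ?thesis
        unfolding y_def by (subst finite_measure_Union[symmetric]) auto
    qed
    ultimately show ?thesis using measure_nonneg[of M "{X \<in> space M. all_escape k X \<and> barren j X}"] by linarith
  next
    case True
    have "incseq x" by (rule incseq_SucI) (rule mono_x)
    moreover have "\<forall>n. x n \<le> 1" unfolding x_def by simp
    ultimately obtain q where q: "x \<longlonglongrightarrow> q"
      by (rule incseq_convergent)
    have "(\<lambda>n. x (Suc n)) \<longlonglongrightarrow> exp (- m * (1 - q))"
      unfolding x_Suc by (intro tendsto_intros q)
    then have fix_q: "q = exp (- m * (1 - q))"
      using q(1) LIMSEQ_Suc LIMSEQ_unique by blast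
    have "y 0 \<le> q"
    proof (rule ccontr)
      assume "\<not> y 0 \<le> q"
      then have "1 - y 0 < 1 - exp (- m * (1 - y 0))"
        using True fix_q m by (intro convexity_gap[of m _ "1 - q"]) auto
      then show False using mono_y[of 0] y_Suc[of 0] by simp
    qed
    have y_le: "y n \<le> q" for n
    proof (induction n)
      case (Suc n)
      then have "exp (- m * (1 - y n)) \<le> exp (- m * (1 - q))" using m by simp
      then show ?case unfolding y_Suc fix_q[symmetric] .
    qed (rule \<open>y 0 \<le> q\<close>)
    have "prob {X \<in> space M. all_escape k X \<and> barren j X} \<le> q - x n" if "n \<ge> j" for n
    proof -
      have "prob {X \<in> space M. all_escape k X \<and> barren j X} + x n \<le> y n"
      proof -
        have "prob {X \<in> space M. all_escape k X \<and> barren j X} + x n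
          = prob ({X \<in> space M. all_escape k X \<and> barren j X} \<union> {X \<in> space M. shorter n X})"
          unfolding x_def using not_shorter_if_all_escape
          by (subst finite_measure_Union) auto
        also have "\<dots> \<le> y n"
          unfolding y_def
        proof (rule finite_measure_mono)
          show "{X \<in> space M. all_escape k X \<and> barren j X} \<union> {X \<in> space M. shorter n X}
              \<subseteq> {X \<in> space M. barren n X}"
            using that by (force simp: barren_def shorter_def)
        qed measurable
        finally show ?thesis .
      qed
      then show ?thesis using y_le[of n] by linarith
    qed
    moreover have "(\<lambda>n. q - x n) \<longlonglongrightarrow> 0" using tendsto_diff[OF tendsto_const q(1), of q] by simp
    ultimately have "prob {X \<in> space M. all_escape k X \<and> barren j X} \<le> 0"
      by (intro LIMSEQ_le_const[of _ 0]) auto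
    then show ?thesis by (intro antisym measure_nonneg)
  qed
qed

text \<open>Up to a null set, the root has infinitely many friends as soon as it escapes for every
  color.\<close>
theorem f_star_inf_eq_prob_all_escape:
  "f_star_inf k rate = prob {X \<in> space M. all_escape k X}"
proof -
  note [measurable] = measurable_infinite_friends measurable_barren measurable_all_escape
  have sub: "{X \<in> space M. infinite (friends_of_root k X)} \<subseteq> {X \<in> space M. all_escape k X}"
    using all_escape_if_infinitely_many_friends by auto
  have "{X \<in> space M. all_escape k X} \<subseteq> {X \<in> space M. infinite (friends_of_root k X)} \<union>
      (\<Union>j. {X \<in> space M. all_escape k X \<and> barren j X})"
  proof
    fix X assume X: "X \<in> {X \<in> space M. all_escape k X}"
    show "X \<in> {X \<in> space M. infinite (friends_of_root k X)} \<union> (\<Union>j. {X \<in> space M. all_escape k X \<and> barren j X})"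
    proof (cases "infinite {v \<in> ecbp_tree k X. all_escape k (subtree v X)}")
      case True
      then show ?thesis using infinitely_many_friends_if X by auto
    next
      case False
      define N where "N = Suc (Max (insert 0 (length ` {v \<in> ecbp_tree k X. all_escape k (subtree v X)})))"
      have "length v < N" if "v \<in> ecbp_tree k X" "all_escape k (subtree v X)" for v
        unfolding N_def less_Suc_eq_le using False that by (intro Max_ge) auto
      then have "barren N X" by (force simp: barren_def)
      then show ?thesis using X by auto
    qed
  qed
  then have "prob {X \<in> space M. all_escape k X} \<le> prob ({X \<in> space M. infinite (friends_of_root k X)} \<union>
      (\<Union>j. {X \<in> space M. all_escape k X \<and> barren j X}))"
    by (rule finite_measure_mono) measurable
  also have "\<dots> = prob {X \<in> space M. infinite (friends_of_root k X)}"
  proof (rule measure_Un_null_set)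
    show "(\<Union>j. {X \<in> space M. all_escape k X \<and> barren j X}) \<in> null_sets M"
      using prob_all_escape_barren by (intro null_sets_UN) (auto simp: null_sets_def emeasure_eq_measure)
  qed measurable
  finally have "prob {X \<in> space M. all_escape k X} \<le> prob {X \<in> space M. infinite (friends_of_root k X)}" .
  moreover have "prob {X \<in> space M. infinite (friends_of_root k X)} \<le> prob {X \<in> space M. all_escape k X}"
    using sub by (rule finite_measure_mono) measurable
  ultimately show ?thesis by (simp add: f_star_inf_def)
qed

end

section \<open>Inclusion-exclusion over the trapped colors\<close>

text \<open>Differences with the sign that inclusion-exclusion produces:
  nabla n f 0 = \<Sum>j\<le>n. (-1) ^ j (n choose j) f j.\<close>
fun nabla :: "nat \<Rightarrow> (nat \<Rightarrow> real) \<Rightarrow> nat \<Rightarrow> real" where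
  "nabla 0 f t = f t"
| "nabla (Suc n) f t = nabla n f t - nabla n f (Suc t)"

locale symmetric_ecbp =
  fixes k :: nat and l :: real
  assumes k_ge_1: "k \<ge> 1" and l_pos: "l > 0"

sublocale symmetric_ecbp \<subseteq> ecbp k "\<lambda>_. l"
  by unfold_locales (use k_ge_1 l_pos in auto)

context symmetric_ecbp
begin

definition unreached :: "nat \<Rightarrow> nat set \<Rightarrow> (vertex \<times> nat \<Rightarrow> nat) \<Rightarrow> bool" where
  "unreached n S X \<longleftrightarrow> (\<forall>i\<in>S. \<not> reach k i n X)"

definition trapped :: "nat set \<Rightarrow> (vertex \<times> nat \<Rightarrow> nat) \<Rightarrow> bool" where
  "trapped S X \<longleftrightarrow> (\<forall>i\<in>S. \<not> escapes k i X)"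

definition trap_prob :: "nat \<Rightarrow> real" where
  "trap_prob s = prob {X \<in> space M. trapped {1..s} X}"

text \<open>The probability that no descent of n steps from the root avoids any of the colors in a set S
  of size s. It only depends on s: a child along an edge of color c must fail for the colors in
  S - {c}, since a path through it uses c; these are s - 1 colors if c \<in> S, and s colors otherwise.\<close>
fun unreached_prob :: "nat \<Rightarrow> nat \<Rightarrow> real" where
  "unreached_prob 0 s = (if s = 0 then 1 else 0)"
| "unreached_prob (Suc n) s =
     exp (l * (real s * unreached_prob n (s - 1) + real (k - s) * unreached_prob n s - real k))"

lemma unreached_Suc:
  "unreached (Suc n) S X \<longleftrightarrow> (\<forall>c\<in>{1..k}. \<forall>j<X ([], c). unreached n (S - {c}) (subtree [(c, j)] X))"
  unfolding unreached_def reach.simps by blast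

lemma measurable_unreached: "finite S \<Longrightarrow> Measurable.pred M (unreached n S)"
proof -
  assume [measurable]: "finite S"
  note [measurable] = measurable_reach
  show ?thesis unfolding unreached_def by measurable
qed

lemma measurable_trapped: "finite S \<Longrightarrow> Measurable.pred M (trapped S)"
proof -
  assume [measurable]: "finite S"
  note [measurable] = measurable_escapes
  show ?thesis unfolding trapped_def by measurable
qed

lemma prob_unreached:
  assumes "S \<subseteq> {1..k}"
  shows "prob {X \<in> space M. unreached n S X} = unreached_prob n (card S)"
  using assms
proof (induction n arbitrary: S)
  case 0
  have "finite S" using 0 finite_subset by blast
  then show ?case by (cases "S = {}") (auto simp: unreached_def prob_space)
next
  case (Suc n)
  have fin: "finite S" using Suc.prems finite_subset by blast
  have "prob {X \<in> space M. unreached (Suc n) S X}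
      = exp (- (\<Sum>c=1..k. l * (1 - prob {X \<in> space M. unreached n (S - {c}) X})))"
    unfolding unreached_Suc by (rule prob_all_children) (use fin in \<open>simp add: measurable_unreached\<close>)
  also have "(\<Sum>c=1..k. l * (1 - prob {X \<in> space M. unreached n (S - {c}) X}))
      = (\<Sum>c=1..k. l * (1 - unreached_prob n (card (S - {c}))))"
    using Suc by (intro sum.cong refl) (subst Suc.IH, auto)
  also have "\<dots> = (\<Sum>c\<in>S. l * (1 - unreached_prob n (card (S - {c})))) + (\<Sum>c\<in>{1..k} - S. l * (1 - unreached_prob n (card (S - {c}))))"
    by (subst sum.subset_diff[OF Suc.prems]) (simp_all add: add.commute)
  also have "(\<Sum>c\<in>S. l * (1 - unreached_prob n (card (S - {c})))) = (\<Sum>c\<in>S. l * (1 - unreached_prob n (card S - 1)))"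
    by (intro sum.cong) (use fin in auto)
  also have "(\<Sum>c\<in>{1..k} - S. l * (1 - unreached_prob n (card (S - {c})))) = (\<Sum>c\<in>{1..k} - S. l * (1 - unreached_prob n (card S)))"
    by (intro sum.cong) auto
  finally have "prob {X \<in> space M. unreached (Suc n) S X} =
     exp (- (real (card S) * (l * (1 - unreached_prob n (card S - 1))) + real (k - card S) * (l * (1 - unreached_prob n (card S)))))"
    using Suc.prems fin by (simp add: card_Diff_subset)
  moreover have "real (k - card S) = real k - real (card S)"
    using card_mono[OF _ Suc.prems] by (simp add: of_nat_diff)
  ultimately show ?case by (simp add: algebra_simps)
qed

lemma unreached_prob_tendsto:
  assumes "S \<subseteq> {1..k}"
  shows "(\<lambda>n. unreached_prob n (card S)) \<longlonglongrightarrow> prob {X \<in> space M. trapped S X}"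
proof -
  have fin: "finite S" using assms finite_subset by blast
  have "(\<lambda>n. prob {X \<in> space M. unreached n S X}) \<longlonglongrightarrow> prob (\<Union>n. {X \<in> space M. unreached n S X})"
  proof (rule finite_Lim_measure_incseq)
    show "range (\<lambda>n. {X \<in> space M. unreached n S X}) \<subseteq> events"
      using measurable_unreached[OF fin] by auto
    show "incseq (\<lambda>n. {X \<in> space M. unreached n S X})"
      using reach_mono by (intro incseq_SucI) (auto simp: unreached_def simp del: reach.simps)
  qed
  also have "(\<Union>n. {X \<in> space M. unreached n S X}) = {X \<in> space M. trapped S X}"
  proof safe
    fix X n assume "unreached n S X"
    then show "trapped S X" by (auto simp: unreached_def trapped_def escapes_def)
  next
    fix X assume X: "X \<in> space M" "trapped S X"
    then obtain N where N: "\<And>i. i \<in> S \<Longrightarrow> \<not> reach k i (N i) X"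
      unfolding trapped_def escapes_def by metis
    have "unreached (Max (insert 0 (N ` S))) S X"
      unfolding unreached_def
    proof
      fix i assume i: "i \<in> S"
      then have "N i \<le> Max (insert 0 (N ` S))" using fin by (intro Max_ge) auto
      then show "\<not> reach k i (Max (insert 0 (N ` S))) X" using N[OF i] reach_antimono by blast
    qed
    then show "X \<in> (\<Union>n. {X \<in> space M. unreached n S X})" using X by blast
  qed
  finally show ?thesis using prob_unreached[OF assms] by simp
qed

lemma unreached_prob_tendsto_trap_prob:
  "s \<le> k \<Longrightarrow> (\<lambda>n. unreached_prob n s) \<longlonglongrightarrow> trap_prob s"
  using unreached_prob_tendsto[of "{1..s}"] by (simp add: trap_prob_def)

lemma prob_trapped: "S \<subseteq> {1..k} \<Longrightarrow> prob {X \<in> space M. trapped S X} = trap_prob (card S)"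
  using LIMSEQ_unique[OF unreached_prob_tendsto unreached_prob_tendsto_trap_prob] card_mono[of "{1..k}" S]
  by simp

lemma trap_prob_fixpoint:
  assumes "s \<le> k"
  shows "trap_prob s = exp (l * (real s * trap_prob (s - 1) + real (k - s) * trap_prob s - real k))"
proof -
  have "(\<lambda>n. unreached_prob (Suc n) s) \<longlonglongrightarrow>
      exp (l * (real s * trap_prob (s - 1) + real (k - s) * trap_prob s - real k))"
    unfolding unreached_prob.simps
    using assms by (intro tendsto_intros unreached_prob_tendsto_trap_prob) auto
  then show ?thesis
    using unreached_prob_tendsto_trap_prob[OF assms] LIMSEQ_Suc LIMSEQ_unique by blast
qed

lemma trap_prob_0: "trap_prob 0 = 1"
  by (simp add: trap_prob_def trapped_def prob_space)

lemma trap_prob_nonneg: "trap_prob s \<ge> 0" and trap_prob_le_1: "trap_prob s \<le> 1"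
  by (simp_all add: trap_prob_def)

text \<open>The iteration for a single color starts at 0, below 1 - d, and the hypothesis says that one
  step maps values below 1 - d to values below 1 - d. This is what excludes the trivial
  fixed point 1.\<close>
lemma trap_prob_1_le:
  assumes "exp (- (l * real (k - 1)) * d) \<le> 1 - d" "d \<le> 1"
  shows "trap_prob 1 \<le> 1 - d"
proof -
  have zero: "unreached_prob n 0 = 1" for n by (induction n) auto
  have "unreached_prob n 1 \<le> 1 - d" for n
  proof (induction n)
    case (Suc n)
    have k: "real (k - 1) = real k - 1" using k_ge_1 by (simp add: of_nat_diff)
    have "unreached_prob (Suc n) 1 = exp (l * (1 + real (k - 1) * unreached_prob n 1 - real k))"
      by (simp add: zero)
    also have "\<dots> = exp (- (l * real (k - 1)) * (1 - unreached_prob n 1))"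
      unfolding k by (rule arg_cong[of _ _ exp]) algebra
    finally have "unreached_prob (Suc n) 1 = exp (- (l * real (k - 1)) * (1 - unreached_prob n 1))" .
    also have "\<dots> \<le> exp (- (l * real (k - 1)) * d)"
      using Suc l_pos by (simp add: mult_left_mono)
    finally show ?case using assms by linarith
  qed (use assms in simp)
  then show ?thesis
    using unreached_prob_tendsto_trap_prob[of 1] k_ge_1 by (intro LIMSEQ_le_const2) auto
qed

text \<open>Inclusion-exclusion, one color at a time: moving a color to the escaping set subtracts the
  probability with that color among the trapped ones, which is one more difference.\<close>
lemma prob_escape_trapped:
  assumes "finite A" "A \<subseteq> {1..k}" "S \<subseteq> {1..k}" "A \<inter> S = {}"
  shows "prob {X \<in> space M. (\<forall>i\<in>A. escapes k i X) \<and> trapped S X} = nabla (card A) trap_prob (card S)"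
  using assms
proof (induction A arbitrary: S rule: finite_induct)
  case empty
  then show ?case using prob_trapped by simp
next
  case (insert a A)
  have finS: "finite S" using insert.prems finite_subset by blast
  have meas: "{X \<in> space M. (\<forall>i\<in>A. escapes k i X) \<and> trapped T X} \<in> events" if [measurable]: "finite T" for T
  proof -
    note [measurable] = measurable_escapes measurable_trapped insert.hyps(1)
    show ?thesis by measurable
  qed
  define E where "E T = {X \<in> space M. (\<forall>i\<in>A. escapes k i X) \<and> trapped T X}" for T
  have "{X \<in> space M. (\<forall>i\<in>insert a A. escapes k i X) \<and> trapped S X} = E S - E (insert a S)"
    by (auto simp: E_def trapped_def)
  moreover have "prob (E S - E (insert a S)) = prob (E S) - prob (E (insert a S))"
  proof (rule finite_measure_Diff)
    show "E (insert a S) \<subseteq> E S" by (auto simp: E_def trapped_def)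
  qed (use meas finS in \<open>simp_all add: E_def\<close>)
  moreover have "prob (E S) = nabla (card A) trap_prob (card S)"
    unfolding E_def
  proof (rule insert.IH)
    show "A \<subseteq> {1..k}" "S \<subseteq> {1..k}" "A \<inter> S = {}" using insert.prems by blast+
  qed
  moreover have "prob (E (insert a S)) = nabla (card A) trap_prob (card (insert a S))"
    unfolding E_def
  proof (rule insert.IH)
    show "A \<subseteq> {1..k}" "insert a S \<subseteq> {1..k}" "A \<inter> insert a S = {}"
      using insert.prems insert.hyps by blast+
  qed
  moreover have "card (insert a S) = Suc (card S)" "card (insert a A) = Suc (card A)"
    using insert.prems insert.hyps finS by auto
  ultimately show ?case by simp
qed

theorem f_star_inf_eq_nabla: "f_star_inf k (\<lambda>_. l) = nabla k trap_prob 0"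
  using prob_escape_trapped[of "{1..k}" "{}"] f_star_inf_eq_prob_all_escape
  by (simp add: all_escape_def trapped_def)

end

section \<open>Iterated differences at scale \<epsilon>\<close>

lemma nabla_Suc': "nabla (Suc n) f t = nabla n (\<lambda>t. f t - f (Suc t)) t"
  by (induction n arbitrary: t) auto

lemma nabla_cmult: "nabla n (\<lambda>t. c * f t) t = c * nabla n f t"
  by (induction n arbitrary: t) (auto simp: algebra_simps)

lemma nabla_add: "nabla n (\<lambda>t. f t + g t) t = nabla n f t + nabla n g t"
  by (induction n arbitrary: t) auto

lemma nabla_const: "nabla n (\<lambda>t. c) t = (if n = 0 then c else 0)"
  by (induction n arbitrary: t) auto

text \<open>The n-th difference is affine in the last value it sees, with slope (-1) ^ n.\<close>
lemma nabla_last_value: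
  assumes "\<And>i. i < t + n \<Longrightarrow> f i = g i"
  shows "nabla n f t - nabla n g t = (-1) ^ n * (f (t + n) - g (t + n))"
  using assms
proof (induction n arbitrary: t)
  case (Suc n)
  have "nabla n f t - nabla n g t = 0" using Suc.IH[of t] Suc.prems by simp
  moreover have "nabla n f (Suc t) - nabla n g (Suc t) = (-1) ^ n * (f (Suc t + n) - g (Suc t + n))"
    by (rule Suc.IH) (use Suc.prems in simp)
  ultimately show ?case by (simp add: algebra_simps)
qed simp

lemma nabla_cong:
  assumes "\<And>i. i \<le> t + n \<Longrightarrow> f i = g i"
  shows "nabla n f t = nabla n g t"
  using nabla_last_value[of t n f g] assms by simp

lemma nabla_tendsto:
  assumes "\<And>i. i \<le> t + n \<Longrightarrow> ((\<lambda>e. f e i) \<longlongrightarrow> g i) F"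
  shows "((\<lambda>e. nabla n (f e) t) \<longlongrightarrow> nabla n g t) F"
  using assms
proof (induction n arbitrary: t)
  case (Suc n)
  then show ?case by (auto intro!: tendsto_diff)
qed simp

text \<open>This diagonalizes the recursion: in terms of differences at 0, the coupling between
  neighboring values t - 1 and t becomes multiplication of the j-th difference by k - j. The
  combinatorial reason is that a child reaching infinity for a set of j colors transmits all of it
  to its parent exactly if the connecting edge has one of the other k - j colors.\<close>
lemma nabla_index_weight:
  "nabla j (\<lambda>t. real t * q (t - 1) + (k - real t) * q t) t
     = real t * nabla j q (t - 1) + (k - real t - real j) * nabla j q t"
proof (induction j arbitrary: t)
  case (Suc j)
  show ?case unfolding nabla.simps Suc by (cases t) (simp_all add: algebra_simps)
qed simp

text \<open>The sequence f e behaves up to order n like t \<mapsto> F (- e t) for a smooth function F with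
  derivatives a j at 0. The quotients are required at all t that only involve f e 0, ..., f e n, so
  that the notion survives shifts and difference quotients.\<close>
definition has_jet :: "nat \<Rightarrow> (real \<Rightarrow> nat \<Rightarrow> real) \<Rightarrow> (nat \<Rightarrow> real) \<Rightarrow> bool" where
  "has_jet n f a \<longleftrightarrow> (\<forall>j t. j + t \<le> n \<longrightarrow> ((\<lambda>e. nabla j (f e) t / e ^ j) \<longlongrightarrow> a j) (at_right 0))"

lemma has_jetD: "has_jet n f a \<Longrightarrow> j + t \<le> n \<Longrightarrow> ((\<lambda>e. nabla j (f e) t / e ^ j) \<longlongrightarrow> a j) (at_right 0)"
  by (simp add: has_jet_def)

lemma has_jet_mono: "has_jet n f a \<Longrightarrow> m \<le> n \<Longrightarrow> has_jet m f a"
  by (simp add: has_jet_def)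

lemma eventually_pos: "\<forall>\<^sub>F e in at_right (0::real). e > 0"
  by (simp add: eventually_at_right_less)

lemma tendsto_ident_right: "((\<lambda>e::real. e) \<longlongrightarrow> 0) (at_right 0)"
  by (rule tendsto_ident_at)

text \<open>A difference at Suc t is the one at t minus the next higher difference at t, which is
  smaller by a factor e.\<close>
lemma has_jet_from_0:
  assumes "\<And>j. j \<le> n \<Longrightarrow> ((\<lambda>e. nabla j (f e) 0 / e ^ j) \<longlongrightarrow> a j) (at_right 0)"
  shows "has_jet n f a"
proof -
  have "((\<lambda>e. nabla j (f e) t / e ^ j) \<longlongrightarrow> a j) (at_right 0)" if "j + t \<le> n" for j t
    using that
  proof (induction t arbitrary: j)
    case 0
    then show ?case using assms by simp
  next
    case (Suc t)
    have "((\<lambda>e. nabla j (f e) t / e ^ j - e * (nabla (Suc j) (f e) t / e ^ Suc j)) \<longlongrightarrow> a j - 0 * a (Suc j)) (at_right 0)"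
      using Suc by (intro tendsto_intros Suc.IH) auto
    moreover have "\<forall>\<^sub>F e in at_right 0. nabla j (f e) t / e ^ j - e * (nabla (Suc j) (f e) t / e ^ Suc j)
        = nabla j (f e) (Suc t) / e ^ j"
      using eventually_pos by eventually_elim (simp add: field_simps)
    ultimately show ?case by (simp add: tendsto_cong)
  qed
  then show ?thesis by (simp add: has_jet_def)
qed

lemma has_jet_add: "has_jet n f a \<Longrightarrow> has_jet n g b \<Longrightarrow> has_jet n (\<lambda>e t. f e t + g e t) (\<lambda>j. a j + b j)"
  unfolding has_jet_def nabla_add add_divide_distrib by (auto intro!: tendsto_add)

lemma has_jet_shift: "has_jet (Suc n) f a \<Longrightarrow> has_jet n (\<lambda>e t. f e (Suc t)) a"
proof -
  assume f: "has_jet (Suc n) f a"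
  have "nabla j (\<lambda>t. g (Suc t)) t = nabla j g (Suc t)" for j t and g :: "nat \<Rightarrow> real"
    by (induction j arbitrary: t) auto
  with f show ?thesis by (simp add: has_jet_def)
qed

lemma has_jet_diff_quotient:
  assumes "has_jet (Suc n) f a"
  shows "has_jet n (\<lambda>e t. (f e t - f e (Suc t)) / e) (\<lambda>j. a (Suc j))"
proof -
  have "nabla j (\<lambda>t. (f e t - f e (Suc t)) / e) t / e ^ j = nabla (Suc j) (f e) t / e ^ Suc j" for j e t
    using nabla_cmult[of j "inverse e" "\<lambda>t. f e t - f e (Suc t)" t]
    by (simp add: nabla_Suc' field_simps del: nabla.simps(2))
  then show ?thesis using assms by (simp add: has_jet_def del: nabla.simps power_Suc)
qed

text \<open>The n-th derivative at 0 of a product of functions with derivatives a and b, unfolded by the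
  product rule.\<close>
primrec leibniz :: "nat \<Rightarrow> (nat \<Rightarrow> real) \<Rightarrow> (nat \<Rightarrow> real) \<Rightarrow> real" where
  "leibniz 0 a b = a 0 * b 0"
| "leibniz (Suc n) a b = leibniz n (\<lambda>j. a (Suc j)) b + leibniz n a (\<lambda>j. b (Suc j))"

text \<open>The discrete product rule has a shifted factor, but a shift does not change the jet.\<close>
lemma has_jet_mult:
  assumes "has_jet n f a" "has_jet n g b"
  shows "has_jet n (\<lambda>e t. f e t * g e t) (\<lambda>j. leibniz j a b)"
  using assms
proof (induction n arbitrary: f g a b)
  case 0
  then show ?case by (auto simp: has_jet_def intro: tendsto_mult)
next
  case (Suc n)
  note fg = Suc.prems
  define F where "F e t = (f e t - f e (Suc t)) / e" for e t
  define G where "G e t = (g e t - g e (Suc t)) / e" for e t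
  have "has_jet n F (\<lambda>j. a (Suc j))" "has_jet n G (\<lambda>j. b (Suc j))"
    unfolding F_def G_def using fg by (auto intro: has_jet_diff_quotient)
  moreover have "has_jet n f a" "has_jet n g b"
    using fg has_jet_mono[of "Suc n" _ _ n] by auto
  ultimately have "has_jet n (\<lambda>e t. F e t * g e t + f e (Suc t) * G e t)
      (\<lambda>j. leibniz j (\<lambda>j. a (Suc j)) b + leibniz j a (\<lambda>j. b (Suc j)))"
    using fg by (intro has_jet_add Suc.IH has_jet_shift)
  note step = this[unfolded leibniz.simps(2)[symmetric]]
  show ?case
    unfolding has_jet_def
  proof (intro allI impI)
    fix j t assume jt: "j + t \<le> Suc n"
    show "((\<lambda>e. nabla j (\<lambda>t. f e t * g e t) t / e ^ j) \<longlongrightarrow> leibniz j a b) (at_right 0)"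
    proof (cases j)
      case 0
      then show ?thesis
        using has_jetD[OF fg(1), of 0 t] has_jetD[OF fg(2), of 0 t] jt by (auto intro: tendsto_mult)
    next
      case (Suc i)
      have "((\<lambda>e. nabla i (\<lambda>t. F e t * g e t + f e (Suc t) * G e t) t / e ^ i) \<longlongrightarrow> leibniz j a b) (at_right 0)"
        using has_jetD[OF step, of i t] jt Suc by simp
      moreover have "\<forall>\<^sub>F e in at_right 0. nabla i (\<lambda>t. F e t * g e t + f e (Suc t) * G e t) t / e ^ i
          = nabla j (\<lambda>t. f e t * g e t) t / e ^ j"
        using eventually_pos
      proof eventually_elim
        case (elim e)
        have "F e t * g e t + f e (Suc t) * G e t = inverse e * (f e t * g e t - f e (Suc t) * g e (Suc t))" for t
          using elim by (simp add: F_def G_def field_simps)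
        then show ?case
          unfolding Suc nabla_Suc' by (simp only: nabla_cmult power_Suc) (simp add: field_simps)
      qed
      ultimately show ?thesis by (rule Lim_transform_eventually)
    qed
  qed
qed

lemma has_jet_const: "has_jet n (\<lambda>_ _. c) (\<lambda>j. if j = 0 then c else 0)"
  by (auto simp: has_jet_def nabla_const)

primrec power_jet :: "(nat \<Rightarrow> real) \<Rightarrow> nat \<Rightarrow> nat \<Rightarrow> real" where
  "power_jet a 0 = (\<lambda>j. if j = 0 then 1 else 0)"
| "power_jet a (Suc m) = (\<lambda>j. leibniz j a (power_jet a m))"

lemma has_jet_power:
  "has_jet n f a \<Longrightarrow> has_jet n (\<lambda>e t. f e t ^ m) (power_jet a m)"
  by (induction m) (auto intro: has_jet_const has_jet_mult)

lemma has_jet_cmult: "has_jet n f a \<Longrightarrow> has_jet n (\<lambda>e t. c * f e t) (\<lambda>j. c * a j)"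
  unfolding has_jet_def nabla_cmult times_divide_eq_right[symmetric]
  by (simp del: times_divide_eq_right add: tendsto_mult_left)

lemma has_jet_sum:
  "finite A \<Longrightarrow> (\<And>m. m \<in> A \<Longrightarrow> has_jet n (f m) (a m)) \<Longrightarrow>
     has_jet n (\<lambda>e t. \<Sum>m\<in>A. f m e t) (\<lambda>j. \<Sum>m\<in>A. a m j)"
proof (induction A rule: finite_induct)
  case empty
  show ?case using has_jet_const[of n 0] by simp
next
  case (insert m A)
  then show ?case by (simp add: has_jet_add)
qed

text \<open>A sequence of size o(e ^ n) is invisible to all differences of order up to n.\<close>
lemma has_jet_negligible:
  assumes "\<And>t. t \<le> n \<Longrightarrow> ((\<lambda>e. r e t / e ^ n) \<longlongrightarrow> 0) (at_right 0)"
  shows "has_jet n r (\<lambda>_. 0)"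
proof -
  have *: "((\<lambda>e. nabla j (r e) t / e ^ n) \<longlongrightarrow> 0) (at_right 0)" if "j + t \<le> n" for j t
    using that
  proof (induction j arbitrary: t)
    case (Suc j)
    have "((\<lambda>e. nabla j (r e) t / e ^ n - nabla j (r e) (Suc t) / e ^ n) \<longlongrightarrow> 0 - 0) (at_right 0)"
      using Suc.prems by (intro tendsto_diff Suc.IH) auto
    then show ?case by (simp add: diff_divide_distrib)
  qed (use assms in simp)
  have "((\<lambda>e. nabla j (r e) t / e ^ j) \<longlongrightarrow> 0) (at_right 0)" if jt: "j + t \<le> n" for j t
  proof -
    have "((\<lambda>e. nabla j (r e) t / e ^ n * e ^ (n - j)) \<longlongrightarrow> 0 * 0 ^ (n - j)) (at_right 0)"
      using jt by (intro tendsto_mult * tendsto_power tendsto_ident_right)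
    moreover have "\<forall>\<^sub>F e in at_right 0. nabla j (r e) t / e ^ n * e ^ (n - j) = nabla j (r e) t / e ^ j"
      using eventually_pos
    proof eventually_elim
      case (elim e)
      have "e ^ n = e ^ j * e ^ (n - j)" using jt by (simp add: power_add[symmetric])
      then show ?case using elim by simp
    qed
    ultimately show ?thesis by (simp add: tendsto_cong)
  qed
  then show ?thesis by (simp add: has_jet_def)
qed

lemma exp_remainder_bound:
  fixes x :: real
  shows "\<bar>exp x - (\<Sum>m\<le>n. x ^ m / fact m)\<bar> \<le> exp \<bar>x\<bar> * \<bar>x\<bar> ^ Suc n"
proof -
  obtain t where t: "\<bar>t\<bar> \<le> \<bar>x\<bar>" "exp x = (\<Sum>m<Suc n. x ^ m / fact m) + exp t / fact (Suc n) * x ^ Suc n"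
    using Maclaurin_exp_le[of x "Suc n"] by blast
  have "\<bar>exp x - (\<Sum>m\<le>n. x ^ m / fact m)\<bar> = exp t / fact (Suc n) * \<bar>x\<bar> ^ Suc n"
    unfolding t(2) lessThan_Suc_atMost by (simp add: abs_mult power_abs del: fact_Suc power_Suc)
  also have "\<dots> \<le> exp \<bar>x\<bar> * \<bar>x\<bar> ^ Suc n"
  proof (rule mult_right_mono)
    have "exp t / fact (Suc n) \<le> exp t / 1"
      by (intro divide_left_mono) (simp_all del: fact_Suc)
    also have "\<dots> \<le> exp \<bar>x\<bar>" using t(1) by simp
    finally show "exp t / fact (Suc n) \<le> exp \<bar>x\<bar>" .
  qed simp
  finally show ?thesis .
qed

text \<open>The exponential series truncated at n. For j \<le> n and b 0 = 0 this is the j-th derivative at 0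
  of exp \<circ> F, where F has the derivatives b: higher powers of F vanish to an order above n.\<close>
definition exp_jet :: "nat \<Rightarrow> (nat \<Rightarrow> real) \<Rightarrow> nat \<Rightarrow> real" where
  "exp_jet n b j = (\<Sum>m\<le>n. power_jet b m j / fact m)"

text \<open>As w e 0 = 0, all values w e t are of size O(e), so the exponential series may be cut off
  after n terms with an error O(e ^ (n + 1)).\<close>
lemma has_jet_exp:
  assumes w: "has_jet n w b" and w0: "\<And>e. w e 0 = 0" and n: "n \<ge> 1"
  shows "has_jet n (\<lambda>e t. exp (w e t)) (exp_jet n b)"
proof -
  have slope: "((\<lambda>e. w e t / e) \<longlongrightarrow> - real t * b 1) (at_right 0)" if "t \<le> n" for t
    using that
  proof (induction t)
    case (Suc t)
    have "((\<lambda>e. w e t / e - nabla 1 (w e) t / e ^ 1) \<longlongrightarrow> - real t * b 1 - b 1) (at_right 0)"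
      using Suc by (intro tendsto_diff Suc.IH has_jetD[OF w]) auto
    moreover have "- real t * b 1 - b 1 = - real (Suc t) * b 1" by (simp add: algebra_simps)
    ultimately show ?case by (simp add: diff_divide_distrib[symmetric])
  qed (simp add: w0)
  define r where "r e t = exp (w e t) - (\<Sum>m\<le>n. w e t ^ m / fact m)" for e t
  have "has_jet n r (\<lambda>_. 0)"
  proof (rule has_jet_negligible)
    fix t assume t: "t \<le> n"
    have wt: "((\<lambda>e. w e t) \<longlongrightarrow> 0) (at_right 0)"
    proof -
      have "((\<lambda>e. w e t / e * e) \<longlongrightarrow> - real t * b 1 * 0) (at_right 0)"
        by (intro tendsto_mult slope t tendsto_ident_right)
      moreover have "\<forall>\<^sub>F e in at_right 0. w e t / e * e = w e t"
        using eventually_pos by eventually_elim simp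
      ultimately show ?thesis by (simp add: tendsto_cong)
    qed
    have "((\<lambda>e. exp \<bar>w e t\<bar> * \<bar>w e t\<bar> * \<bar>w e t / e\<bar> ^ n) \<longlongrightarrow> exp \<bar>0\<bar> * \<bar>0\<bar> * \<bar>- real t * b 1\<bar> ^ n) (at_right 0)"
      by (intro tendsto_intros slope wt t)
    then have lim: "((\<lambda>e. exp \<bar>w e t\<bar> * \<bar>w e t\<bar> * \<bar>w e t / e\<bar> ^ n) \<longlongrightarrow> 0) (at_right 0)" by simp
    show "((\<lambda>e. r e t / e ^ n) \<longlongrightarrow> 0) (at_right 0)"
    proof (rule Lim_null_comparison[OF _ lim])
      show "\<forall>\<^sub>F e in at_right 0. norm (r e t / e ^ n) \<le> exp \<bar>w e t\<bar> * \<bar>w e t\<bar> * \<bar>w e t / e\<bar> ^ n"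
        using eventually_pos
      proof eventually_elim
        case (elim e)
        have "\<bar>r e t\<bar> / e ^ n \<le> exp \<bar>w e t\<bar> * \<bar>w e t\<bar> ^ Suc n / e ^ n"
          unfolding r_def using elim by (intro divide_right_mono exp_remainder_bound) auto
        then show ?case using elim by (simp add: abs_divide power_divide mult.assoc)
      qed
    qed
  qed
  moreover have "has_jet n (\<lambda>e t. \<Sum>m\<le>n. 1 / fact m * w e t ^ m) (\<lambda>j. \<Sum>m\<le>n. 1 / fact m * power_jet b m j)"
    by (intro has_jet_sum has_jet_cmult has_jet_power w) auto
  ultimately have "has_jet n (\<lambda>e t. r e t + (\<Sum>m\<le>n. 1 / fact m * w e t ^ m))
      (\<lambda>j. 0 + (\<Sum>m\<le>n. 1 / fact m * power_jet b m j))"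
    by (rule has_jet_add)
  then show ?thesis by (simp add: r_def exp_jet_def[abs_def])
qed

lemma leibniz_ge:
  assumes "\<And>j. a j \<ge> 0" "\<And>j. b j \<ge> 0"
  shows "leibniz n a b \<ge> a 0 * b n"
  using assms
proof (induction n arbitrary: a b)
  case (Suc n)
  have "0 \<le> a 1 * b n" using Suc.prems by simp
  also have "\<dots> \<le> leibniz n (\<lambda>j. a (Suc j)) b" using Suc.IH[of "\<lambda>j. a (Suc j)" b] Suc.prems by simp
  finally have "0 \<le> leibniz n (\<lambda>j. a (Suc j)) b" .
  moreover have "a 0 * b (Suc n) \<le> leibniz n a (\<lambda>j. b (Suc j))"
    using Suc.IH[of a "\<lambda>j. b (Suc j)"] Suc.prems by simp
  ultimately show ?case by simp
qed simp

lemma leibniz_nonneg: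
  assumes "\<And>j. a j \<ge> 0" "\<And>j. b j \<ge> 0"
  shows "leibniz n a b \<ge> 0"
  using leibniz_ge[of a b n] assms by (meson mult_nonneg_nonneg order_trans)

lemma power_jet_nonneg: "(\<And>j. a j \<ge> 0) \<Longrightarrow> power_jet a m j \<ge> 0"
  by (induction m arbitrary: j) (auto intro: leibniz_nonneg)

text \<open>Up to a factor, power_jet a m m is (a 1) ^ m plus nonnegative terms.\<close>
lemma power_jet_diagonal_pos:
  assumes "\<And>j. a j \<ge> 0" "a 1 > 0"
  shows "power_jet a m m > 0"
proof (induction m)
  case (Suc m)
  have "0 < a 1 * power_jet a m m" using Suc assms by simp
  also have "\<dots> \<le> leibniz m (\<lambda>j. a (Suc j)) (power_jet a m)"
    using leibniz_ge[of "\<lambda>j. a (Suc j)" "power_jet a m" m] assms power_jet_nonneg by simp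
  also have "\<dots> \<le> power_jet a (Suc m) (Suc m)"
    using assms power_jet_nonneg by (auto intro!: leibniz_nonneg)
  finally show ?case .
qed simp

lemma exp_jet_diagonal_pos:
  assumes "\<And>j. a j \<ge> 0" "a 1 > 0"
  shows "exp_jet n a n > 0"
  unfolding exp_jet_def
proof (rule sum_pos2[of _ n])
  show "0 < power_jet a n n / fact n" using power_jet_diagonal_pos[of a n] assms by simp
qed (use power_jet_nonneg[of a] assms in auto)

lemma exp_jet_2: "b 0 = 0 \<Longrightarrow> exp_jet 2 b 2 = b 2 + b 1 ^ 2"
  by (simp add: exp_jet_def numeral_eq_Suc fact_numeral)

lemma exp_jet_3: "b 0 = 0 \<Longrightarrow> exp_jet 3 b 3 = b 3 + 3 * b 1 * b 2 + b 1 ^ 3"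
  by (simp add: exp_jet_def numeral_eq_Suc)

lemma exp_jet_4:
  "b 0 = 0 \<Longrightarrow> exp_jet 4 b 4 = b 4 + 4 * b 1 * b 3 + 3 * b 2 ^ 2 + 6 * b 1 ^ 2 * b 2 + b 1 ^ 4"
  by (simp add: exp_jet_def numeral_eq_Suc)

section \<open>The limit constants\<close>

text \<open>For s \<le> k, the limit of the probability that s given colors all escape, divided by \<epsilon> ^ s. To leading order
  the s colors are partitioned into blocks, each served by a different child, and exp_jet sums over
  these partitions. The case of a single child serving all s colors is not part of the sum (the
  argument vanishes at s). It reproduces the unknown with weight (k - s) / (k - 1), and solving for
  the unknown gives the factor 1 / (1 - (k - s) / (k - 1)) = (k - 1) / (s - 1).\<close>
fun friend_coeff :: "nat \<Rightarrow> nat \<Rightarrow> real" where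
  "friend_coeff k s =
    (if s = 0 then 1 else if s = 1 then 2
     else (real k - 1) / (real s - 1) *
       exp_jet s (\<lambda>j. if 0 < j \<and> j < s then (real k - real j) / (real k - 1) * friend_coeff k j else 0) s)"

declare friend_coeff.simps [simp del]

lemma friend_coeff_0 [simp]: "friend_coeff k 0 = 1"
  and friend_coeff_1 [simp]: "friend_coeff k (Suc 0) = 2"
  by (simp_all add: friend_coeff.simps)

text \<open>The coefficient of the mean number of children through which the root reaches infinity for
  all of j < s given colors; the connecting edge has one of the k - j other colors.\<close>
definition child_coeff :: "nat \<Rightarrow> nat \<Rightarrow> nat \<Rightarrow> real" where
  "child_coeff k s j = (if 0 < j \<and> j < s then (real k - real j) / (real k - 1) * friend_coeff k j else 0)"

lemma friend_coeff_rec: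
  "s \<ge> 2 \<Longrightarrow> friend_coeff k s = (real k - 1) / (real s - 1) * exp_jet s (child_coeff k s) s"
  by (subst friend_coeff.simps) (simp add: child_coeff_def[abs_def])

lemma friend_coeff_pos:
  assumes "k \<ge> 2" "s \<le> k"
  shows "friend_coeff k s > 0"
  using assms(2)
proof (induction s rule: less_induct)
  case (less s)
  consider "s = 0" | "s = 1" | "s \<ge> 2" by linarith
  then show ?case
  proof cases
    case 3
    have "exp_jet s (child_coeff k s) s > 0"
    proof (rule exp_jet_diagonal_pos)
      show "child_coeff k s j \<ge> 0" for j
        using less.IH[of j] less.prems assms(1) by (auto simp: child_coeff_def intro!: mult_nonneg_nonneg)
      show "child_coeff k s 1 > 0" using 3 assms(1) by (simp add: child_coeff_def)
    qed
    then show ?thesis using 3 assms(1) by (simp add: friend_coeff_rec)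
  qed simp_all
qed

lemma friend_coeff_2: "friend_coeff k 2 = (real k - 1) * (child_coeff k 2 1)\<^sup>2"
  by (simp add: friend_coeff_rec exp_jet_2 child_coeff_def)

lemma friend_coeff_2_2: "friend_coeff 2 2 = 4"
  by (simp add: friend_coeff_2 child_coeff_def)

lemma friend_coeff_3_3: "friend_coeff 3 3 = 32"
  by (simp add: friend_coeff_rec[of 3] exp_jet_3 friend_coeff_2 child_coeff_def)

lemma friend_coeff_4_4: "friend_coeff 4 4 = 624"
proof -
  have 2: "friend_coeff 4 2 = 12"
    by (simp add: friend_coeff_2 child_coeff_def)
  have 3: "friend_coeff 4 3 = 84"
    by (simp add: friend_coeff_rec[of 3] exp_jet_3 2 child_coeff_def)
  show ?thesis
    by (simp add: friend_coeff_rec[of 4] exp_jet_4 2 3 child_coeff_def)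
qed

section \<open>Asymptotics near criticality\<close>

text \<open>What the asymptotic analysis needs to know about the probability q e t that t given colors
  are trapped. For t = 1 the equation also allows q e 1 = 1; the last assumption excludes this
  solution, and its bound is already sharp to first order.\<close>
locale trap_family =
  fixes k :: nat and q :: "real \<Rightarrow> nat \<Rightarrow> real"
  assumes k_ge_2: "k \<ge> 2"
    and q_0: "\<And>e. e > 0 \<Longrightarrow> q e 0 = 1"
    and q_eq: "\<And>e t. e > 0 \<Longrightarrow> t \<le> k \<Longrightarrow> q e t =
      exp ((1 + e) / (real k - 1) * (real t * q e (t - 1) + (real k - real t) * q e t - real k))"
    and q_nonneg: "\<And>e t. e > 0 \<Longrightarrow> q e t \<ge> 0"
    and q_le_1: "\<And>e t. e > 0 \<Longrightarrow> q e t \<le> 1"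
    and q_1_le: "\<And>e. e > 0 \<Longrightarrow> q e 1 \<le> 1 - 2 * e / (1 + e)\<^sup>2"
begin

abbreviation rate :: "real \<Rightarrow> real" where "rate e \<equiv> (1 + e) / (real k - 1)"

lemma tendsto_rate: "((\<lambda>e. rate e) \<longlongrightarrow> 1 / (real k - 1)) (at_right 0)"
proof -
  have "((\<lambda>e. rate e) \<longlongrightarrow> (1 + 0) / (real k - 1)) (at_right 0)"
    by (intro tendsto_intros tendsto_ident_right) (use k_ge_2 in auto)
  then show ?thesis by simp
qed

text \<open>The survival probability u of a Poisson branching process with mean 1 + e. The lower bound is
  an assumption; for the upper bound, expand u = 1 - exp (- y) with y = (1 + e) u to third
  order.\<close>
lemma survival_asymptotics: "((\<lambda>e. (1 - q e 1) / e) \<longlongrightarrow> 2) (at_right 0)"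
proof (rule tendsto_sandwich)
  have ev: "\<forall>\<^sub>F e in at_right (0::real). 0 < e \<and> e < 1 / 2"
    using eventually_at_right_real[of 0 "1 / 2 :: real"] by (simp add: greaterThanLessThan_iff)
  show "\<forall>\<^sub>F e in at_right 0. 2 / (1 + e)\<^sup>2 \<le> (1 - q e 1) / e"
    using ev
  proof eventually_elim
    case (elim e)
    then show ?case using q_1_le[of e] by (simp add: field_simps)
  qed
  show "\<forall>\<^sub>F e in at_right 0. (1 - q e 1) / e \<le> 2 + 16 / 3 * e"
    using ev
  proof eventually_elim
    case (elim e)
    define u where "u = 1 - q e 1"
    define y where "y = (1 + e) * u"
    have "u \<ge> 2 * e / (1 + e)\<^sup>2" using q_1_le[of e] elim by (simp add: u_def)
    moreover have "2 * e / (1 + e)\<^sup>2 > 0" using elim by simp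
    ultimately have u: "u > 0" by linarith
    have "u \<le> 1" using q_nonneg[of e 1] elim by (simp add: u_def)
    then have y: "y > 0" "y \<le> 3 / 2" using u elim mult_mono[of "1 + e" "3/2" u 1] by (auto simp: y_def)
    have uy: "u \<le> y" unfolding y_def using u elim by (simp add: algebra_simps)
    have "q e 1 = exp ((1 + e) / (real k - 1) * (q e 0 + (real k - 1) * q e 1 - real k))"
      using q_eq[of e 1] elim k_ge_2 by simp
    also have "(1 + e) / (real k - 1) * (q e 0 + (real k - 1) * q e 1 - real k) = - y"
      using k_ge_2 elim by (simp add: q_0 y_def u_def divide_simps) (simp add: algebra_simps)
    finally have exp_y: "exp (- y) = 1 - u" by (simp add: u_def)
    obtain t where "exp (- y) = (\<Sum>m<4. (- y) ^ m / fact m) + exp t / fact 4 * (- y) ^ 4"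
      using Maclaurin_exp_le[of "- y" 4] by blast
    moreover have "exp t / fact 4 * (- y) ^ 4 \<ge> 0" by simp
    ultimately have "1 - u \<ge> 1 - y + y ^ 2 / 2 - y ^ 3 / 6"
      unfolding exp_y by (simp add: eval_nat_numeral)
    then have "(1 + e) * (y - y ^ 2 / 2 + y ^ 3 / 6) \<ge> (1 + e) * u"
      using elim by (intro mult_left_mono) auto
    moreover have "(1 + e) * (y - y ^ 2 / 2 + y ^ 3 / 6) = y * ((1 + e) * (1 - y / 2 + y ^ 2 / 6))"
      by (simp add: power2_eq_square power3_eq_cube algebra_simps)
    ultimately have "y * ((1 + e) * (1 - y / 2 + y ^ 2 / 6)) \<ge> y * 1"
      by (simp add: y_def[symmetric])
    then have main: "(1 + e) * (1 - y / 2 + y ^ 2 / 6) \<ge> 1"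
      using y(1) by (simp only: mult_le_cancel_left_pos)
    have small: "y\<^sup>2 \<le> 3 / 2 * y" using y mult_right_mono[of y "3/2" y] by (simp add: power2_eq_square)
    have nn: "y / 2 - y\<^sup>2 / 6 \<ge> 0" using small y by linarith
    then have "e * (y / 2 - y\<^sup>2 / 6) \<ge> 0" using elim by simp
    moreover have "(1 + e) * (1 - y / 2 + y ^ 2 / 6) = 1 + e - (y / 2 - y\<^sup>2 / 6) - e * (y / 2 - y\<^sup>2 / 6)"
      by (simp add: field_simps)
    ultimately have half: "y / 2 - y\<^sup>2 / 6 \<le> e" using main by linarith
    with small have y4: "y \<le> 4 * e" by linarith
    then have "y\<^sup>2 \<le> 16 * e\<^sup>2" using y power_mono[of y "4 * e" 2] by (simp add: power_mult_distrib)
    with half uy have "u \<le> 2 * e + 16 / 3 * e\<^sup>2" by linarith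
    then show ?case using elim unfolding u_def[symmetric]
      by (simp add: divide_simps power2_eq_square) (simp add: algebra_simps)
  qed
  have "((\<lambda>e::real. 2 / (1 + e)\<^sup>2) \<longlongrightarrow> 2 / (1 + 0)\<^sup>2) (at_right 0)"
    by (intro tendsto_intros tendsto_ident_right) auto
  then show "((\<lambda>e::real. 2 / (1 + e)\<^sup>2) \<longlongrightarrow> 2) (at_right 0)" by simp
  have "((\<lambda>e::real. 2 + 16 / 3 * e) \<longlongrightarrow> 2 + 16 / 3 * 0) (at_right 0)"
    by (intro tendsto_intros tendsto_ident_right)
  then show "((\<lambda>e::real. 2 + 16 / 3 * e) \<longlongrightarrow> 2) (at_right 0)" by simp
qed

text \<open>For t > 1 the equation, linearized by exp z \<ge> 1 + z, bounds 1 - q e t by a multiple of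
  1 - q e (t - 1): the weight of 1 - q e t itself tends to (k - t) / (k - 1) < 1.\<close>
lemma q_tendsto_1: "t \<le> k \<Longrightarrow> ((\<lambda>e. q e t) \<longlongrightarrow> 1) (at_right 0)"
proof (induction t)
  case 0
  have "\<forall>\<^sub>F e in at_right 0. q e 0 = 1"
    using eventually_pos by eventually_elim (rule q_0)
  then show ?case by (rule tendsto_eventually)
next
  case (Suc t)
  have "((\<lambda>e. 1 - q e (Suc t)) \<longlongrightarrow> 0) (at_right 0)"
  proof (cases "t = 0")
    case True
    have "((\<lambda>e. (1 - q e 1) / e * e) \<longlongrightarrow> 2 * 0) (at_right 0)"
      by (intro tendsto_mult survival_asymptotics tendsto_ident_right)
    moreover have "\<forall>\<^sub>F e in at_right 0. (1 - q e 1) / e * e = 1 - q e 1"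
      using eventually_pos by eventually_elim simp
    ultimately show ?thesis using True by (simp add: tendsto_cong)
  next
    case False
    define a where "a e = 1 - rate e * (real k - real (Suc t))" for e
    have lim_a: "(a \<longlongrightarrow> 1 - 1 / (real k - 1) * (real k - real (Suc t))) (at_right 0)"
      unfolding a_def by (intro tendsto_intros tendsto_rate)
    have a_pos: "1 - 1 / (real k - 1) * (real k - real (Suc t)) > 0"
      using False k_ge_2 by (simp add: field_simps)
    have ev_a: "\<forall>\<^sub>F e in at_right 0. a e > 0"
      using order_tendstoD(1)[OF lim_a a_pos] .
    show ?thesis
    proof (rule tendsto_sandwich)
      show "\<forall>\<^sub>F e in at_right 0. 0 \<le> 1 - q e (Suc t)"
        using eventually_pos by eventually_elim (simp add: q_le_1)
      show "\<forall>\<^sub>F e in at_right 0. 1 - q e (Suc t) \<le> rate e * real (Suc t) * (1 - q e t) / a e"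
        using eventually_pos ev_a
      proof eventually_elim
        case (elim e)
        define z where "z = rate e * (real (Suc t) * q e t + (real k - real (Suc t)) * q e (Suc t) - real k)"
        have "q e (Suc t) = exp z" using q_eq[of e "Suc t"] elim Suc.prems by (simp add: z_def)
        then have "1 - q e (Suc t) \<le> - z" using exp_ge_add_one_self[of z] by linarith
        also have "- z = rate e * real (Suc t) * (1 - q e t) + rate e * (real k - real (Suc t)) * (1 - q e (Suc t))"
          unfolding z_def by algebra
        finally have "(1 - q e (Suc t)) * a e \<le> rate e * real (Suc t) * (1 - q e t)"
          unfolding a_def right_diff_distrib[of "1 - q e (Suc t)"]
          by (simp add: algebra_simps)
        then show ?case using elim(2) by (simp only: pos_le_divide_eq)
      qed
      have "((\<lambda>e. rate e * real (Suc t) * (1 - q e t) / a e) \<longlongrightarrow>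
          1 / (real k - 1) * real (Suc t) * (1 - 1) / (1 - 1 / (real k - 1) * (real k - real (Suc t)))) (at_right 0)"
        using Suc a_pos k_ge_2 False by (intro tendsto_rate lim_a tendsto_divide tendsto_mult tendsto_diff tendsto_const Suc.IH) auto
      then show "((\<lambda>e. rate e * real (Suc t) * (1 - q e t) / a e) \<longlongrightarrow> 0) (at_right 0)" by simp
    qed simp
  qed
  from tendsto_diff[OF tendsto_const this, of 1] show ?case by simp
qed

text \<open>The value 1 at x = 0 makes exp x = 1 + x \<cdot> (increment) hold for all x.\<close>
lemma exp_increment_tendsto: "((\<lambda>x::real. if x = 0 then 1 else (exp x - 1) / x) \<longlongrightarrow> 1) (nhds 0)"
proof -
  have "((\<lambda>x::real. (exp x - 1) / x) \<longlongrightarrow> 1) (at 0)"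
    using DERIV_exp[of "0::real"] by (simp add: has_field_derivative_iff)
  moreover have "\<forall>\<^sub>F x::real in at 0. (exp x - 1) / x = (if x = 0 then 1 else (exp x - 1) / x)"
    by (simp add: eventually_at_filter)
  ultimately have "((\<lambda>x::real. if x = 0 then 1 else (exp x - 1) / x) \<longlongrightarrow> 1) (at 0)"
    by (rule Lim_transform_eventually)
  then show ?thesis by (simp add: tendsto_nhds_iff)
qed

text \<open>By induction on s. The logarithm w of q has j-th difference (1 + e) (k - j) / (k - 1) times that
  of q, so the induction hypothesis gives the jet of w below order s, but the s-th difference of w
  contains the unknown p. Changing the single value w e s removes that difference and leaves a
  sequence v with a complete jet, hence exp v has a known jet. By nabla_last_value, undoing the change adds to the
  s-th difference of exp v a term that is asymptotically (k - s) / (k - 1) times p. As this factor is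
  less than 1, p can be solved for.\<close>
theorem nabla_asymptotics:
  "s \<le> k \<Longrightarrow> ((\<lambda>e. nabla s (q e) 0 / e ^ s) \<longlongrightarrow> friend_coeff k s) (at_right 0)"
proof (induction s rule: less_induct)
  case (less s)
  consider "s = 0" | "s = 1" | "s \<ge> 2" by linarith
  then show ?case
  proof cases
    case 1
    then show ?thesis using q_tendsto_1[of 0] by simp
  next
    case 2
    have "\<forall>\<^sub>F e in at_right 0. (1 - q e 1) / e = nabla 1 (q e) 0 / e ^ 1"
      using eventually_pos by eventually_elim (simp add: q_0)
    with survival_asymptotics have "((\<lambda>e. nabla 1 (q e) 0 / e ^ 1) \<longlongrightarrow> 2) (at_right 0)"
      by (rule Lim_transform_eventually)
    then show ?thesis by (simp add: 2 del: nabla.simps)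
  next
    case 3
    define w where "w e t = rate e * (real t * q e (t - 1) + (real k - real t) * q e t - real k)" for e t
    define p where "p e = nabla s (q e) 0" for e
    \<comment> \<open>This is the s-th difference of w e at 0.\<close>
    define \<eta> where "\<eta> e = rate e * (real k - real s) * p e" for e
    \<comment> \<open>The sequence w with its value at s changed so that the s-th difference vanishes. The case
      t = 0 makes v e 0 = 0 hold for all e, not only for positive e.\<close>
    define v where "v e t = (if t = 0 then 0 else if t = s then w e s - (-1) ^ s * \<eta> e else w e t)" for e t
    have q_exp: "q e t = exp (w e t)" if "e > 0" "t \<le> s" for e t
      using q_eq[of e t] that less.prems by (simp add: w_def)
    have w_0: "w e 0 = 0" if "e > 0" for e using q_0[OF that] by (simp add: w_def)
    have nabla_w: "nabla j (w e) 0 = rate e * (real k - real j) * nabla j (q e) 0" if "j > 0" for j e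
    proof -
      have "w e = (\<lambda>t. rate e * (real t * q e (t - 1) + (real k - real t) * q e t) + (- rate e * real k))"
        by (auto simp: w_def fun_eq_iff right_diff_distrib)
      then have "nabla j (w e) 0 = rate e * nabla j (\<lambda>t. real t * q e (t - 1) + (real k - real t) * q e t) 0"
        using that by (simp only: nabla_add nabla_cmult nabla_const) simp
      also have "nabla j (\<lambda>t. real t * q e (t - 1) + (real k - real t) * q e t) 0 = (real k - real j) * nabla j (q e) 0"
        using nabla_index_weight[of j "q e" "real k" 0] by simp
      finally show ?thesis by simp
    qed
    have jet_v: "has_jet s v (child_coeff k s)"
    proof (rule has_jet_from_0)
      fix j assume j: "j \<le> s"
      consider "j = 0" | "0 < j" "j < s" | "j = s" "0 < j" using j by linarith
      then show "((\<lambda>e. nabla j (v e) 0 / e ^ j) \<longlongrightarrow> child_coeff k s j) (at_right 0)"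
      proof cases
        case 1
        then show ?thesis by (simp add: v_def child_coeff_def)
      next
        case 2
        have "((\<lambda>e. rate e * (real k - real j) * (nabla j (q e) 0 / e ^ j))
            \<longlongrightarrow> 1 / (real k - 1) * (real k - real j) * friend_coeff k j) (at_right 0)"
          using 2 less.prems by (intro tendsto_mult tendsto_rate tendsto_const less.IH) auto
        moreover have "\<forall>\<^sub>F e in at_right 0. rate e * (real k - real j) * (nabla j (q e) 0 / e ^ j) = nabla j (v e) 0 / e ^ j"
          using eventually_pos
        proof eventually_elim
          case (elim e)
          have "nabla j (v e) 0 = nabla j (w e) 0"
            by (rule nabla_cong) (use 2 w_0 elim in \<open>auto simp: v_def\<close>)
          then show ?case using nabla_w[of j e] 2 by simp
        qed
        ultimately have "((\<lambda>e. nabla j (v e) 0 / e ^ j)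
            \<longlongrightarrow> 1 / (real k - 1) * (real k - real j) * friend_coeff k j) (at_right 0)"
          by (rule Lim_transform_eventually)
        then show ?thesis using 2 by (simp add: child_coeff_def)
      next
        case 3
        have "\<forall>\<^sub>F e in at_right 0. nabla j (v e) 0 / e ^ j = 0"
          using eventually_pos
        proof eventually_elim
          case (elim e)
          have "nabla s (v e) 0 - nabla s (w e) 0 = (-1) ^ s * (v e (0 + s) - w e (0 + s))"
            by (rule nabla_last_value) (use w_0 elim in \<open>auto simp: v_def\<close>)
          also have "\<dots> = - ((-1) ^ s * (-1) ^ s * \<eta> e)" using 3 by (simp add: v_def)
          also have "\<dots> = - \<eta> e" by (simp add: power_mult_distrib[symmetric])
          finally have "nabla s (v e) 0 = nabla s (w e) 0 - \<eta> e" by simp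
          then show ?case using nabla_w[of s e] 3 by (simp add: \<eta>_def p_def)
        qed
        then show ?thesis using 3 by (simp add: child_coeff_def tendsto_eventually)
      qed
    qed
    have jet_exp: "has_jet s (\<lambda>e t. exp (v e t)) (exp_jet s (child_coeff k s))"
      using 3 by (intro has_jet_exp jet_v) (auto simp: v_def)
    have lim_p: "(p \<longlongrightarrow> 0) (at_right 0)"
    proof -
      have "((\<lambda>e. nabla s (q e) 0) \<longlongrightarrow> nabla s (\<lambda>_. 1) 0) (at_right 0)"
        by (rule nabla_tendsto) (use less.prems q_tendsto_1 in auto)
      then show ?thesis using 3 by (simp add: nabla_const p_def[abs_def])
    qed
    have "(\<eta> \<longlongrightarrow> 1 / (real k - 1) * (real k - real s) * 0) (at_right 0)"
      unfolding \<eta>_def by (intro tendsto_mult tendsto_rate tendsto_const lim_p)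
    then have lim_\<eta>: "((\<lambda>e. (-1) ^ s * \<eta> e) \<longlongrightarrow> 0) (at_right 0)"
      by (intro tendsto_mult_right_zero) simp
    define \<rho> where "\<rho> x = (if x = 0 then 1 else (exp x - 1) / x)" for x :: real
    have lim_\<rho>: "((\<lambda>e. \<rho> ((-1) ^ s * \<eta> e)) \<longlongrightarrow> 1) (at_right 0)"
      using filterlim_compose[OF exp_increment_tendsto lim_\<eta>] unfolding \<rho>_def .
    have lim_v: "((\<lambda>e. exp (v e s)) \<longlongrightarrow> 1) (at_right 0)"
      using has_jetD[OF jet_exp, of 0 s] by (simp add: exp_jet_def sum.atMost_shift child_coeff_def)
    \<comment> \<open>The equation for p will read: s-th difference of exp v = p e * d e.\<close>
    define d where "d e = 1 - exp (v e s) * \<rho> ((-1) ^ s * \<eta> e) * (rate e * (real k - real s))" for e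
    have lim_d: "(d \<longlongrightarrow> 1 - 1 * 1 * (1 / (real k - 1) * (real k - real s))) (at_right 0)"
      unfolding d_def by (intro tendsto_diff tendsto_mult tendsto_const tendsto_rate lim_v lim_\<rho>)
    have d_eq: "1 - 1 * 1 * (1 / (real k - 1) * (real k - real s)) = (real s - 1) / (real k - 1)"
      using k_ge_2 by (simp add: field_simps)
    have d_pos: "(real s - 1) / (real k - 1) > 0" using 3 k_ge_2 by simp
    have "((\<lambda>e. nabla s (\<lambda>t. exp (v e t)) 0 / e ^ s / d e)
        \<longlongrightarrow> exp_jet s (child_coeff k s) s / ((real s - 1) / (real k - 1))) (at_right 0)"
      using d_pos by (intro tendsto_divide lim_d[unfolded d_eq] has_jetD[OF jet_exp]) auto
    moreover have "\<forall>\<^sub>F e in at_right 0. nabla s (\<lambda>t. exp (v e t)) 0 / e ^ s / d e = nabla s (q e) 0 / e ^ s"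
      using eventually_pos order_tendstoD(1)[OF lim_d[unfolded d_eq] d_pos]
    proof eventually_elim
      case (elim e)
      define \<sigma> :: real where "\<sigma> = (-1) ^ s"
      have \<sigma>: "\<sigma> * \<sigma> = 1" by (simp add: \<sigma>_def power_mult_distrib[symmetric])
      have "p e - nabla s (\<lambda>t. exp (v e t)) 0 = \<sigma> * (q e (0 + s) - exp (v e (0 + s)))"
        unfolding p_def \<sigma>_def
      proof (rule nabla_last_value)
        fix i assume "i < 0 + s"
        then show "q e i = exp (v e i)"
          using q_exp[of e i] elim w_0[of e] by (auto simp: v_def)
      qed
      also have "q e (0 + s) = exp (v e s) * exp (\<sigma> * \<eta> e)"
        using q_exp[of e s] elim 3 by (simp add: v_def \<sigma>_def exp_add[symmetric])
      also have "exp (\<sigma> * \<eta> e) = 1 + \<sigma> * \<eta> e * \<rho> (\<sigma> * \<eta> e)"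
        by (simp add: \<rho>_def)
      also have "\<sigma> * (exp (v e s) * (1 + \<sigma> * \<eta> e * \<rho> (\<sigma> * \<eta> e)) - exp (v e (0 + s)))
          = (\<sigma> * \<sigma>) * (exp (v e s) * \<eta> e * \<rho> (\<sigma> * \<eta> e))"
        by (simp add: algebra_simps)
      finally have "p e - nabla s (\<lambda>t. exp (v e t)) 0 = exp (v e s) * \<eta> e * \<rho> (\<sigma> * \<eta> e)"
        unfolding \<sigma> by simp
      then have "nabla s (\<lambda>t. exp (v e t)) 0 = p e - exp (v e s) * \<rho> (\<sigma> * \<eta> e) * \<eta> e"
        by (simp add: mult_ac)
      also have "\<dots> = p e - exp (v e s) * \<rho> (\<sigma> * \<eta> e) * (rate e * (real k - real s) * p e)"
        by (simp only: \<eta>_def[symmetric])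
      also have "\<dots> = p e * d e"
        unfolding d_def \<sigma>_def[symmetric] by (simp only: right_diff_distrib mult_1_right mult_ac)
      finally have "nabla s (\<lambda>t. exp (v e t)) 0 = p e * d e" .
      then show ?case using elim by (simp add: p_def)
    qed
    ultimately have "((\<lambda>e. nabla s (q e) 0 / e ^ s)
        \<longlongrightarrow> exp_jet s (child_coeff k s) s / ((real s - 1) / (real k - 1))) (at_right 0)"
      by (rule Lim_transform_eventually)
    then show ?thesis using 3 by (simp add: friend_coeff_rec mult.commute)
  qed
qed

end

text \<open>Only the bound for one color takes an argument: with y = 2 e / (1 + e) the inequality
  exp (- y) \<le> 1 - y + y ^ 2 / 2 turns into the supersolution property required by trap_prob_1_le.\<close>
lemma trap_family_trap_prob:
  assumes k: "k \<ge> 2"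
  shows "trap_family k (\<lambda>e. symmetric_ecbp.trap_prob k ((1 + e) / (real k - 1)))"
proof
  fix e :: real and t :: nat assume e: "e > 0"
  define l where "l = (1 + e) / (real k - 1)"
  interpret symmetric_ecbp k l
    by unfold_locales (use k e in \<open>auto simp: l_def\<close>)
  show "symmetric_ecbp.trap_prob k ((1 + e) / (real k - 1)) 0 = 1"
    "symmetric_ecbp.trap_prob k ((1 + e) / (real k - 1)) t \<ge> 0"
    "symmetric_ecbp.trap_prob k ((1 + e) / (real k - 1)) t \<le> 1"
    unfolding l_def[symmetric] by (rule trap_prob_0 trap_prob_nonneg trap_prob_le_1)+
  show "symmetric_ecbp.trap_prob k ((1 + e) / (real k - 1)) t =
      exp ((1 + e) / (real k - 1) * (real t * symmetric_ecbp.trap_prob k ((1 + e) / (real k - 1)) (t - 1)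
        + (real k - real t) * symmetric_ecbp.trap_prob k ((1 + e) / (real k - 1)) t - real k))"
    if "t \<le> k"
    unfolding l_def[symmetric] using trap_prob_fixpoint[OF that] that by (simp add: of_nat_diff)
  show "symmetric_ecbp.trap_prob k ((1 + e) / (real k - 1)) 1 \<le> 1 - 2 * e / (1 + e)\<^sup>2"
    unfolding l_def[symmetric]
  proof (rule trap_prob_1_le)
    define d where "d = 2 * e / (1 + e)\<^sup>2"
    have "2 * e \<le> (1 + e)\<^sup>2" using zero_le_power2[of e] by (simp add: power2_sum)
    then show "2 * e / (1 + e)\<^sup>2 \<le> 1" using e by (simp add: divide_le_eq)
    have l: "l * real (k - 1) = 1 + e" using k by (simp add: l_def of_nat_diff)
    define y where "y = (1 + e) * d"
    have y: "y \<ge> 0" using e by (simp add: y_def d_def)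
    obtain t where "exp (- y) = (\<Sum>m<3. (- y) ^ m / fact m) + exp t / fact 3 * (- y) ^ 3"
      using Maclaurin_exp_le[of "- y" 3] by blast
    moreover have "exp t / fact 3 * (- y) ^ 3 \<le> 0" using y by (simp add: mult_nonneg_nonpos)
    ultimately have "exp (- y) \<le> 1 - y + y\<^sup>2 / 2" by (simp add: eval_nat_numeral)
    also have "y\<^sup>2 / 2 = d * (d * (1 + e)\<^sup>2) / 2" by (simp add: y_def power2_eq_square mult_ac)
    also have "d * (1 + e)\<^sup>2 = 2 * e" using e by (simp add: d_def)
    also have "d * (2 * e) / 2 = e * d" by simp
    also have "1 - y + e * d = 1 - d" by (simp add: y_def algebra_simps)
    finally show "exp (- (l * real (k - 1)) * (2 * e / (1 + e)\<^sup>2)) \<le> 1 - 2 * e / (1 + e)\<^sup>2"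
      unfolding l by (simp only: y_def d_def mult_minus_left)
  qed
qed (rule k)

theorem theorem2p20:
  shows "\<exists>C :: nat \<Rightarrow> real.
    (\<forall>k\<ge>2. C k > 0 \<and>
       ((\<lambda>\<epsilon>. f_star_inf k (near_critical_rate k \<epsilon>) / \<epsilon> ^ k) \<longlongrightarrow> C k) (at_right 0)) \<and>
    C 2 = 4 \<and> C 3 = 32 \<and> C 4 = 624"
proof (intro exI[of _ "\<lambda>k. friend_coeff k k"] conjI allI impI)
  fix k :: nat assume k: "k \<ge> 2"
  show "friend_coeff k k > 0" using friend_coeff_pos[OF k order_refl] .
  interpret trap_family k "\<lambda>e. symmetric_ecbp.trap_prob k ((1 + e) / (real k - 1))"
    using k by (rule trap_family_trap_prob)
  have "\<forall>\<^sub>F e in at_right 0. nabla k (symmetric_ecbp.trap_prob k ((1 + e) / (real k - 1))) 0 / e ^ k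
      = f_star_inf k (near_critical_rate k e) / e ^ k"
    using eventually_pos
  proof eventually_elim
    case (elim e)
    interpret symmetric_ecbp k "(1 + e) / (real k - 1)"
      by unfold_locales (use k elim in auto)
    show ?case using f_star_inf_eq_nabla by (simp add: near_critical_rate_def)
  qed
  with nabla_asymptotics[OF order_refl]
  show "((\<lambda>\<epsilon>. f_star_inf k (near_critical_rate k \<epsilon>) / \<epsilon> ^ k) \<longlongrightarrow> friend_coeff k k) (at_right 0)"
    by (rule Lim_transform_eventually)
qed (simp_all add: friend_coeff_2_2 friend_coeff_3_3 friend_coeff_4_4)

end
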